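(* Let $p$ be an odd prime and let $G$ be a finite $p$-group. If the nilpotency class of $G$ is at most $p$, then $\exp(G\wedge G)\mid \exp(G)$. In particular, $\exp(M(G))\mid \exp(G)$.
   Context: $\exp(X)$ denotes the exponent of a group $X$. Write ${}^g h=ghg^{-1}$. The nonabelian tensor square $G\otimes G$ is the group generated by symbols $g\otimes h$ ($g,h\in G$) subject to the relations $gg'\otimes h=({}^g g'\otimes {}^g h)(g\otimes h)$ and $g\otimes hh'=(g\otimes h)({}^h g\otimes {}^h h')$ for all $g,g',h,h'\in G$. The (nonabelian) exterior square is $G\wedge G=(G\otimes G)/\nabla(G)$, where $\nabla(G)$ is the subgroup generated by all $x\otimes x$, $x\in G$. The Schur multiplier is $M(G)=H_2(G,\mathbb{Z})$; it is isomorphic to the kernel of the homomorphism $G\wedge G\to [G,G]$, $g\wedge h\mapsto [g,h]=ghg^{-1}h^{-1}$. *)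

theory Defs
  imports "HOL-Algebra.Algebra" "HOL-Library.Extended_Nat"
begin

section \<open>Exponent and nilpotency class\<close>

text \<open>The value 0 encodes infinite exponent, so \<open>group_exponent X dvd n\<close> with \<open>n > 0\<close>
  includes the assertion that the exponent of \<open>X\<close> is finite.\<close>

definition group_exponent :: "('a, 'b) monoid_scheme \<Rightarrow> nat" where
  "group_exponent G =
     (if \<exists>n>0. \<forall>x\<in>carrier G. x [^]\<^bsub>G\<^esub> (n::nat) = \<one>\<^bsub>G\<^esub>
      then LEAST n. 0 < n \<and> (\<forall>x\<in>carrier G. x [^]\<^bsub>G\<^esub> (n::nat) = \<one>\<^bsub>G\<^esub>)
      else 0)"

text \<open>Indexing from 0: \<open>lower_central G n\<close> is the term usually written gamma_(n+1).\<close>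

primrec lower_central :: "('a, 'b) monoid_scheme \<Rightarrow> nat \<Rightarrow> 'a set" where
  "lower_central G 0 = carrier G"
| "lower_central G (Suc n) =
     generate G (\<Union>x\<in>lower_central G n. \<Union>g\<in>carrier G.
       {x \<otimes>\<^bsub>G\<^esub> g \<otimes>\<^bsub>G\<^esub> inv\<^bsub>G\<^esub> x \<otimes>\<^bsub>G\<^esub> inv\<^bsub>G\<^esub> g})"

text \<open>The class is \<open>\<infinity>\<close> (the infimum of the empty set) if \<open>G\<close> is not nilpotent.\<close>

definition nilpotency_class :: "('a, 'b) monoid_scheme \<Rightarrow> enat" where
  "nilpotency_class G = Inf {enat c | c. lower_central G c = {\<one>\<^bsub>G\<^esub>}}"

section \<open>Groups given by generators and relations\<close>

text \<open>A letter \<open>(x, True)\<close> stands for the generator \<open>x\<close> and \<open>(x, False)\<close> for its formal inverse.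
  A relation is a pair of words to be identified. The presented group consists of the classes
  of words modulo the least congruence that contains the relations and makes \<open>(x, b)\<close> and
  \<open>(x, \<not> b)\<close> mutually inverse.\<close>

type_synonym 'x word = "('x \<times> bool) list"

definition words :: "'x set \<Rightarrow> 'x word set" where
  "words S = lists (S \<times> UNIV)"

inductive_set word_cong :: "'x set \<Rightarrow> ('x word \<times> 'x word) set \<Rightarrow> ('x word \<times> 'x word) set"
  for S :: "'x set" and R :: "('x word \<times> 'x word) set" where
  rel: "\<lbrakk>(u, v) \<in> R; u \<in> words S; v \<in> words S\<rbrakk> \<Longrightarrow> (u, v) \<in> word_cong S R"
| cancel: "x \<in> S \<Longrightarrow> ([(x, b), (x, \<not> b)], []) \<in> word_cong S R"
| refl: "u \<in> words S \<Longrightarrow> (u, u) \<in> word_cong S R"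
| sym: "(u, v) \<in> word_cong S R \<Longrightarrow> (v, u) \<in> word_cong S R"
| trans: "\<lbrakk>(u, v) \<in> word_cong S R; (v, w) \<in> word_cong S R\<rbrakk> \<Longrightarrow> (u, w) \<in> word_cong S R"
| append: "\<lbrakk>(u, u') \<in> word_cong S R; (v, v') \<in> word_cong S R\<rbrakk>
            \<Longrightarrow> (u @ v, u' @ v') \<in> word_cong S R"

definition presented_group ::
    "'x set \<Rightarrow> ('x word \<times> 'x word) set \<Rightarrow> 'x word set monoid" where
  "presented_group S R =
     \<lparr>carrier = words S // word_cong S R,
      monoid.mult = (\<lambda>A B. \<Union>u\<in>A. \<Union>v\<in>B. word_cong S R `` {u @ v}),
      monoid.one = word_cong S R `` {[]}\<rparr>"

lemma word_cong_words: "(u, v) \<in> word_cong S R \<Longrightarrow> u \<in> words S \<and> v \<in> words S"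
  by (induction rule: word_cong.induct) (auto simp: words_def)

lemma equiv_word_cong: "equiv (words S) (word_cong S R)"
proof (rule equivI)
  show "word_cong S R \<subseteq> words S \<times> words S"
    using word_cong_words by (metis mem_Sigma_iff subrelI)
  show "refl_on (words S) (word_cong S R)"
    by (rule refl_onI) (rule word_cong.refl)
  show "sym (word_cong S R)"
    by (rule symI) (rule word_cong.sym)
  show "trans (word_cong S R)"
    by (rule transI) (rule word_cong.trans)
qed

lemma presented_group_mult:
  assumes "u \<in> words S" "v \<in> words S"
  shows "word_cong S R `` {u} \<otimes>\<^bsub>presented_group S R\<^esub> word_cong S R `` {v}
         = word_cong S R `` {u @ v}"
proof -
  let ?A = "word_cong S R `` {u}" and ?B = "word_cong S R `` {v}"
  have "word_cong S R `` {u' @ v'} = word_cong S R `` {u @ v}"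
    if "u' \<in> ?A" "v' \<in> ?B" for u' v'
    using that equiv_class_eq[OF equiv_word_cong word_cong.append] by blast
  then have "(\<Union>u'\<in>?A. \<Union>v'\<in>?B. word_cong S R `` {u' @ v'})
             = (\<Union>u'\<in>?A. \<Union>v'\<in>?B. word_cong S R `` {u @ v})"
    by (intro SUP_cong HOL.refl)
  moreover have "u \<in> ?A" "v \<in> ?B"
    using assms by (blast intro: word_cong.refl)+
  then have "(\<Union>u'\<in>?A. \<Union>v'\<in>?B. word_cong S R `` {u @ v}) = word_cong S R `` {u @ v}"
    by blast
  ultimately show ?thesis
    by (simp add: presented_group_def)
qed

lemma word_inverse:
  "u \<in> words S \<Longrightarrow> (rev (map (\<lambda>(x, b). (x, \<not> b)) u) @ u, []) \<in> word_cong S R"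
proof (induction u)
  case Nil
  then show ?case by (auto simp: words_def intro: word_cong.refl)
next
  case (Cons a u)
  obtain x b where a: "a = (x, b)" by fastforce
  let ?v = "rev (map (\<lambda>(x, b). (x, \<not> b)) u)"
  have x: "x \<in> S" and u: "u \<in> words S" and v: "?v \<in> words S"
    using Cons.prems by (auto simp: words_def a)
  have "([(x, \<not> b), (x, b)], []) \<in> word_cong S R"
    using word_cong.cancel[OF x, of "\<not> b"] by simp
  then have "(?v @ [(x, \<not> b), (x, b)] @ u, ?v @ [] @ u) \<in> word_cong S R"
    by (intro word_cong.append word_cong.refl u v)
  then have "(rev (map (\<lambda>(x, b). (x, \<not> b)) (a # u)) @ a # u, ?v @ u) \<in> word_cong S R"
    by (simp add: a)
  then show ?case
    by (rule word_cong.trans) (rule Cons.IH[OF u])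
qed

lemma group_presented_group: "group (presented_group S R)"
proof (rule groupI)
  let ?P = "presented_group S R"
  have car: "carrier ?P = (\<lambda>u. word_cong S R `` {u}) ` words S"
    by (auto simp: presented_group_def quotient_def)
  have one: "\<one>\<^bsub>?P\<^esub> = word_cong S R `` {[]}"
    by (simp add: presented_group_def)
  have app: "u @ v \<in> words S" if "u \<in> words S" "v \<in> words S" for u v :: "'a word"
    using that by (auto simp: words_def)
  have nil: "[] \<in> words S" by (simp add: words_def)
  show "x \<otimes>\<^bsub>?P\<^esub> y \<in> carrier ?P" if "x \<in> carrier ?P" "y \<in> carrier ?P" for x y
    using that by (auto simp: car presented_group_mult app)
  show "\<one>\<^bsub>?P\<^esub> \<in> carrier ?P" by (auto simp: car one nil)
  show "x \<otimes>\<^bsub>?P\<^esub> y \<otimes>\<^bsub>?P\<^esub> z = x \<otimes>\<^bsub>?P\<^esub> (y \<otimes>\<^bsub>?P\<^esub> z)"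
    if "x \<in> carrier ?P" "y \<in> carrier ?P" "z \<in> carrier ?P" for x y z
    using that by (auto simp: car presented_group_mult app)
  show "\<one>\<^bsub>?P\<^esub> \<otimes>\<^bsub>?P\<^esub> x = x" if "x \<in> carrier ?P" for x
    using that by (auto simp: car one presented_group_mult nil)
  show "\<exists>y\<in>carrier ?P. y \<otimes>\<^bsub>?P\<^esub> x = \<one>\<^bsub>?P\<^esub>" if x: "x \<in> carrier ?P" for x
  proof -
    obtain u where u: "u \<in> words S" "x = word_cong S R `` {u}"
      using x by (auto simp: car)
    let ?v = "rev (map (\<lambda>(x, b). (x, \<not> b)) u)"
    have v: "?v \<in> words S" using u(1) by (auto simp: words_def)
    have "word_cong S R `` {?v} \<otimes>\<^bsub>?P\<^esub> x = \<one>\<^bsub>?P\<^esub>"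
      using equiv_class_eq[OF equiv_word_cong word_inverse[OF u(1)]]
      by (simp add: u(2) presented_group_mult[OF v u(1)] one)
    then show ?thesis using v by (auto simp: car)
  qed
qed

section \<open>Nonabelian tensor square and exterior square\<close>

definition conj_by :: "('a, 'b) monoid_scheme \<Rightarrow> 'a \<Rightarrow> 'a \<Rightarrow> 'a" where
  "conj_by G g h = g \<otimes>\<^bsub>G\<^esub> h \<otimes>\<^bsub>G\<^esub> inv\<^bsub>G\<^esub> g"

text \<open>The generator \<open>(g, h)\<close> is the symbol "g tensor h".\<close>

definition tensor_relations :: "('a, 'b) monoid_scheme \<Rightarrow> (('a \<times> 'a) word \<times> ('a \<times> 'a) word) set"
  where
  "tensor_relations G =
     {([((g \<otimes>\<^bsub>G\<^esub> g', h), True)],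
       [((conj_by G g g', conj_by G g h), True), ((g, h), True)])
       | g g' h. g \<in> carrier G \<and> g' \<in> carrier G \<and> h \<in> carrier G} \<union>
     {([((g, h \<otimes>\<^bsub>G\<^esub> h'), True)],
       [((g, h), True), ((conj_by G h g, conj_by G h h'), True)])
       | g h h'. g \<in> carrier G \<and> h \<in> carrier G \<and> h' \<in> carrier G}"

definition tensor_square :: "('a, 'b) monoid_scheme \<Rightarrow> ('a \<times> 'a) word set monoid" where
  "tensor_square G = presented_group (carrier G \<times> carrier G) (tensor_relations G)"

definition tensor :: "('a, 'b) monoid_scheme \<Rightarrow> 'a \<Rightarrow> 'a \<Rightarrow> ('a \<times> 'a) word set" where
  "tensor G g h =
     word_cong (carrier G \<times> carrier G) (tensor_relations G) `` {[((g, h), True)]}"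

definition nabla :: "('a, 'b) monoid_scheme \<Rightarrow> ('a \<times> 'a) word set set" where
  "nabla G = generate (tensor_square G) ((\<lambda>x. tensor G x x) ` carrier G)"

text \<open>\<open>nabla G\<close> is central in \<open>tensor_square G\<close>, so no normal closure is taken.\<close>

definition exterior_square :: "('a, 'b) monoid_scheme \<Rightarrow> ('a \<times> 'a) word set set monoid" where
  "exterior_square G = tensor_square G Mod nabla G"

section \<open>Schur multiplier\<close>

text \<open>The second integral homology group of \<open>G\<close>, computed from the inhomogeneous bar complex
  with trivial coefficients: the n-chains are free abelian on the n-tuples \<open>[g_1|...|g_n]\<close>, and
  the boundary maps are determined by
  \<open>d2 [g|h] = [h] - [gh] + [g]\<close> and
  \<open>d3 [g|h|k] = [h|k] - [gh|k] + [g|hk] - [g|h]\<close>.\<close>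

definition bar_d2 :: "('a, 'b) monoid_scheme \<Rightarrow> ('a \<times> 'a \<Rightarrow>\<^sub>0 int) \<Rightarrow> ('a \<Rightarrow>\<^sub>0 int)" where
  "bar_d2 G = frag_extend (\<lambda>(g, h). frag_of h - frag_of (g \<otimes>\<^bsub>G\<^esub> h) + frag_of g)"

definition bar_d3 ::
    "('a, 'b) monoid_scheme \<Rightarrow> ('a \<times> 'a \<times> 'a \<Rightarrow>\<^sub>0 int) \<Rightarrow> ('a \<times> 'a \<Rightarrow>\<^sub>0 int)" where
  "bar_d3 G = frag_extend (\<lambda>(g, h, k).
     frag_of (h, k) - frag_of (g \<otimes>\<^bsub>G\<^esub> h, k) + frag_of (g, h \<otimes>\<^bsub>G\<^esub> k) - frag_of (g, h))"

definition bar_cycles2 :: "('a, 'b) monoid_scheme \<Rightarrow> ('a \<times> 'a \<Rightarrow>\<^sub>0 int) set" where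
  "bar_cycles2 G =
     {c \<in> carrier (free_Abelian_group (carrier G \<times> carrier G)). bar_d2 G c = 0}"

definition bar_boundaries2 :: "('a, 'b) monoid_scheme \<Rightarrow> ('a \<times> 'a \<Rightarrow>\<^sub>0 int) set" where
  "bar_boundaries2 G =
     bar_d3 G ` carrier (free_Abelian_group (carrier G \<times> carrier G \<times> carrier G))"

definition schur_multiplier :: "('a, 'b) monoid_scheme \<Rightarrow> ('a \<times> 'a \<Rightarrow>\<^sub>0 int) set monoid" where
  "schur_multiplier G =
     (free_Abelian_group (carrier G \<times> carrier G)) \<lparr>carrier := bar_cycles2 G\<rparr> Mod bar_boundaries2 G"

end

theory Submission
  imports Defs
begin

text \<open>Let \<open>q = p ^ e\<close> be the exponent of \<open>G\<close>. The tensor square \<open>T\<close> itself has exponent dividing \<open>q\<close>,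
  and both the exterior square and the Schur multiplier are sections of \<open>T\<close>.

  \<open>G\<close> acts on \<open>T\<close>; put \<open>\<delta>_g t = (g . t) t^-1\<close> and filter \<open>T\<close> by iterating these maps. Since
  \<open>\<delta>_g t\<close> is the tensor of \<open>g\<close> with the image of \<open>t\<close> in \<open>G\<close>, the class bound makes the filtration
  vanish after \<open>p\<close> steps. If \<open>c\<close> is \<open>g \<otimes> h\<close> or \<open>\<delta>_g t\<close>, the product of the \<open>g^k . c\<close> for \<open>k < n\<close> is
  \<open>g^n \<otimes> h\<close> or \<open>\<delta>_(g^n) t\<close>, which is trivial for \<open>n = q\<close>. As a function of \<open>n\<close> this product is a
  polynomial sequence in the sense of Leibman, so its Taylor expansion gives
  \<open>c^q (\<delta>_g^(p-1) c)^(q choose p) = 1\<close>. Below the top the second factor is trivial, whence \<open>\<delta>_g t\<close> has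
  order dividing \<open>q\<close> and \<open>g \<otimes> h \<mapsto> (g \<otimes> h)^q\<close> is bilinear and alternating. Therefore
  \<open>(x^t y \<otimes> x)^q = (y \<otimes> x)^q\<close> is constant in \<open>t\<close>, while the second factor, evaluated at \<open>x^t y\<close>, is a
  polynomial of degree \<open>p - 1\<close> in \<open>t\<close> with top difference \<open>(p - 1)!\<close> times its value at \<open>x\<close>. So
  \<open>(y \<otimes> x)^q\<close> is killed by \<open>(p - 1)!\<close>; it is also killed by \<open>p\<close>, hence trivial.\<close>

section \<open>Polynomial sequences in filtered groups\<close>

text \<open>The absorption identity \<open>m * (q choose m) = q * (q - 1 choose (m - 1))\<close> for
  \<open>q = p ^ e\<close>, with \<open>m\<close> prime to \<open>p\<close>. It removes the Taylor
  terms of order strictly between 1 and \<open>p\<close>.\<close>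

lemma prime_power_dvd_binomial:
  fixes p e m :: nat
  assumes p: "Factorial_Ring.prime p" and m: "0 < m" "m < p"
  shows "p ^ e dvd (p ^ e choose m)"
proof -
  have "m * (p ^ e choose m) = p ^ e * (p ^ e - 1 choose (m - 1))"
    using m p by (intro times_binomial_minus1_eq) auto
  moreover have "coprime (p ^ e) m"
    using prime_imp_coprime[OF p, of m] m
    by (metis coprime_power_left_iff nat_dvd_not_less)
  ultimately show ?thesis
    by (metis coprime_dvd_mult_right_iff dvd_triv_left)
qed

text \<open>At order \<open>p\<close> the same identity loses one factor \<open>p\<close>. So if
  \<open>q = p ^ e\<close> kills an element, then \<open>p\<close> kills its
  \<open>(q choose p)\<close>-th power.\<close>

lemma prime_power_dvd_prime_mult_binomial:
  fixes p e :: nat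
  assumes "Factorial_Ring.prime p"
  shows "p ^ e dvd p * (p ^ e choose p)"
proof -
  have "p * (p ^ e choose p) = p ^ e * (p ^ e - 1 choose (p - 1))"
    using assms prime_gt_0_nat by (intro times_binomial_minus1_eq) auto
  then show ?thesis by simp
qed

context group
begin

lemma inv_mult_cancel: "x \<in> carrier G \<Longrightarrow> y \<in> carrier G \<Longrightarrow> inv x \<otimes> (x \<otimes> y) = y"
  and mult_inv_cancel: "x \<in> carrier G \<Longrightarrow> y \<in> carrier G \<Longrightarrow> x \<otimes> (inv x \<otimes> y) = y"
  by (simp_all flip: m_assoc)

lemmas word_simps = m_assoc inv_mult_group inv_mult_cancel mult_inv_cancel

lemma conj_eqI:
  assumes "x \<otimes> y = y \<otimes> z" "x \<in> carrier G" "y \<in> carrier G" "z \<in> carrier G"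
  shows "x = y \<otimes> z \<otimes> inv y"
  using assms by (simp flip: assms(1) add: m_assoc)

lemma pow_eq_one_dvd: "\<lbrakk>x \<in> carrier G; x [^] (q::nat) = \<one>; q dvd k\<rbrakk> \<Longrightarrow> x [^] k = \<one>"
  by (metis dvdE nat_pow_one nat_pow_pow)

lemma pow_coprime_eq_one:
  fixes a b :: nat
  assumes x: "x \<in> carrier G" and a: "x [^] a = \<one>" and b: "x [^] b = \<one>" and "coprime a b"
  shows "x = \<one>"
proof -
  obtain u v where "u * int a + v * int b = 1"
    using \<open>coprime a b\<close> by (metis bezout_int coprime_iff_gcd_eq_1 coprime_int_iff)
  then have "x = x [^] (int a * u + int b * v)" using x by (simp add: mult.commute)
  also have "\<dots> = (x [^] int a) [^] u \<otimes> (x [^] int b) [^] v"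
    using x by (simp only: int_pow_mult int_pow_pow)
  also have "\<dots> = \<one>" using a b by (simp add: int_pow_int)
  finally show ?thesis .
qed

lemma subgroup_nat_pow_closed: "\<lbrakk>subgroup H G; x \<in> H\<rbrakk> \<Longrightarrow> x [^] (n::nat) \<in> H"
  by (induction n) (auto simp: subgroup.one_closed subgroup.m_closed)

definition commutator :: "'a \<Rightarrow> 'a \<Rightarrow> 'a" where
  "commutator x y = x \<otimes> y \<otimes> inv x \<otimes> inv y"

lemma commutator_closed [simp]:
  "x \<in> carrier G \<Longrightarrow> y \<in> carrier G \<Longrightarrow> commutator x y \<in> carrier G"
  by (simp add: commutator_def)

lemma conj_by_closed [simp]: "\<lbrakk>g \<in> carrier G; h \<in> carrier G\<rbrakk> \<Longrightarrow> conj_by G g h \<in> carrier G"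
  by (simp add: conj_by_def)

definition diff :: "(nat \<Rightarrow> 'a) \<Rightarrow> nat \<Rightarrow> 'a" where
  "diff f n = f (Suc n) \<otimes> inv f n"

lemma diff_closed [simp]: "f \<in> UNIV \<rightarrow> carrier G \<Longrightarrow> diff f n \<in> carrier G"
  by (auto simp: diff_def Pi_iff)

lemma diff_Pi [simp]: "f \<in> UNIV \<rightarrow> carrier G \<Longrightarrow> diff f \<in> UNIV \<rightarrow> carrier G"
  by (auto simp: diff_def Pi_iff)

lemma diffs_Pi [simp]: "f \<in> UNIV \<rightarrow> carrier G \<Longrightarrow> (diff ^^ k) f \<in> UNIV \<rightarrow> carrier G"
  by (induction k arbitrary: f) (simp_all add: funpow_swap1 del: Pi_iff)

lemma diff_mult:
  assumes "f \<in> UNIV \<rightarrow> carrier G" "g \<in> UNIV \<rightarrow> carrier G"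
  shows "diff (\<lambda>n. f n \<otimes> g n) = (\<lambda>n. diff f n \<otimes> (commutator (f n) (diff g n) \<otimes> diff g n))"
proof
  fix n
  have [simp]: "f k \<in> carrier G" "g k \<in> carrier G" for k using assms by auto
  show "diff (\<lambda>n. f n \<otimes> g n) n = diff f n \<otimes> (commutator (f n) (diff g n) \<otimes> diff g n)"
    by (simp add: diff_def commutator_def word_simps)
qed

text \<open>With \<open>f (Suc n) = c a\<close> and \<open>g (Suc n) = d b\<close> this is an
  identity of words in four letters. Its shape matters: \<open>diff f\<close> or
  \<open>diff g\<close> occurs in every factor, so each factor lies at least one level deeper than
  \<open>commutator (f n) (g n)\<close>.\<close>

lemma diff_commutator:
  assumes "f \<in> UNIV \<rightarrow> carrier G" "g \<in> UNIV \<rightarrow> carrier G"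
  shows "diff (\<lambda>n. commutator (f n) (g n)) = (\<lambda>n.
    commutator (diff f n) (commutator (f n) (g (Suc n))) \<otimes>
    (commutator (f n) (diff g n) \<otimes>
     (commutator (diff g n) (commutator (f n) (g n)) \<otimes>
      (commutator (commutator (f n) (g n)) (commutator (diff f n) (g (Suc n))) \<otimes>
       commutator (diff f n) (g (Suc n))))))"
proof
  fix n
  have [simp]: "f k \<in> carrier G" "g k \<in> carrier G" for k using assms by auto
  define a b c d where "a = f n" and "b = g n" and "c = diff f n" and "d = diff g n"
  have [simp]: "a \<in> carrier G" "b \<in> carrier G" "c \<in> carrier G" "d \<in> carrier G"
    using assms by (simp_all add: a_def b_def c_def d_def)
  have f: "f (Suc n) = c \<otimes> a" and g: "g (Suc n) = d \<otimes> b"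
    by (simp_all add: a_def b_def c_def d_def diff_def m_assoc)
  show "diff (\<lambda>n. commutator (f n) (g n)) n =
    commutator (diff f n) (commutator (f n) (g (Suc n))) \<otimes>
    (commutator (f n) (diff g n) \<otimes>
     (commutator (diff g n) (commutator (f n) (g n)) \<otimes>
      (commutator (commutator (f n) (g n)) (commutator (diff f n) (g (Suc n))) \<otimes>
       commutator (diff f n) (g (Suc n)))))"
    unfolding diff_def[of "\<lambda>n. commutator (f n) (g n)"] f g
      a_def[symmetric] b_def[symmetric] c_def[symmetric] d_def[symmetric]
    by (simp add: commutator_def word_simps)
qed

lemma diff_const: "c \<in> carrier G \<Longrightarrow> diff (\<lambda>n. c) = (\<lambda>n. \<one>)"
  by (simp add: diff_def fun_eq_iff)

lemma diffs_one [simp]: "(diff ^^ k) (\<lambda>n. \<one>) = (\<lambda>n. \<one>)"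
  by (induction k) (simp_all add: diff_const)

text \<open>Pascal's rule. Powers with binomial exponents take the place of monomials in the Taylor
  expansion.\<close>

lemma diff_pow_choose:
  assumes "b \<in> carrier G"
  shows "diff (\<lambda>n. b [^] (n choose Suc m)) = (\<lambda>n. b [^] (n choose m))"
proof
  fix n
  have "b [^] (Suc n choose Suc m) = b [^] (n choose m) \<otimes> b [^] (n choose Suc m)"
    using assms by (simp add: nat_pow_mult)
  then show "diff (\<lambda>n. b [^] (n choose Suc m)) n = b [^] (n choose m)"
    using assms by (simp add: diff_def m_assoc del: binomial_Suc_Suc)
qed

lemma diffs_pow_choose:
  assumes b: "b \<in> carrier G" and "m < k"
  shows "(diff ^^ k) (\<lambda>n. b [^] (n choose m)) = (\<lambda>n. \<one>)"
  using \<open>m < k\<close>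
proof (induction m arbitrary: k)
  case 0
  then obtain k' where "k = Suc k'" using not0_implies_Suc by blast
  then show ?case using b by (simp add: funpow_Suc_right diff_const del: funpow.simps(2))
next
  case (Suc m)
  then obtain k' where "k = Suc k'" "m < k'" by (metis Suc_less_eq2)
  then show ?case using Suc.IH[of k'] b by (simp add: funpow_Suc_right diff_pow_choose del: funpow.simps(2))
qed

text \<open>In the difference triangle all entries with \<open>n + j < m\<close> are trivial, so the
  value \<open>f m\<close> is passed on unchanged along the edge \<open>n + j = m\<close>. For
  \<open>n = 0\<close> this identifies \<open>f m\<close> with the \<open>m\<close>-th difference at
  0.\<close>

lemma diffs_initial_zeros:
  assumes "f \<in> UNIV \<rightarrow> carrier G" and "\<And>i. i < m \<Longrightarrow> f i = \<one>" and "n + j \<le> m"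
  shows "(diff ^^ j) f n = (if n + j = m then f m else \<one>)"
  using assms(3)
proof (induction j arbitrary: n)
  case 0
  then show ?case using assms(2) by simp
next
  case (Suc j)
  have "f m \<in> carrier G" using assms(1) by auto
  then show ?case using Suc.IH[of n] Suc.IH[of "Suc n"] Suc.prems by (auto simp: diff_def)
qed

end

text \<open>Indices are one below the customary weights: with \<open>V (i + 1) = U i\<close> the
  last assumption reads [V a, V b] \<subseteq> V (a + b).\<close>

locale filtered_group = group G for G (structure) +
  fixes U :: "nat \<Rightarrow> 'a set"
  assumes U_subgroup: "subgroup (U i) G"
    and U_Suc: "U (Suc i) \<subseteq> U i"
    and U_commutator: "\<lbrakk>x \<in> U i; y \<in> U j\<rbrakk> \<Longrightarrow> commutator x y \<in> U (Suc (i + j))"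
begin

lemma U_closed: "x \<in> U i \<Longrightarrow> x \<in> carrier G"
  using subgroup.subset[OF U_subgroup] by auto

lemma U_antimono: "i \<le> j \<Longrightarrow> U j \<subseteq> U i"
  using lift_Suc_antimono_le[of U i j, OF U_Suc] by blast

text \<open>\<open>polyseq_upto d i f\<close> bounds only the first \<open>d\<close> differences, so that closure of this class under
  products and commutators can be proved simultaneously by induction on \<open>d\<close>.\<close>

primrec polyseq_upto :: "nat \<Rightarrow> nat \<Rightarrow> (nat \<Rightarrow> 'a) \<Rightarrow> bool" where
  "polyseq_upto 0 i f = (\<forall>n. f n \<in> U i)"
| "polyseq_upto (Suc d) i f = ((\<forall>n. f n \<in> U i) \<and> polyseq_upto d (Suc i) (diff f))"

lemma polyseq_upto_in: "polyseq_upto d i f \<Longrightarrow> f n \<in> U i"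
  by (cases d) auto

lemma polyseq_upto_Pi: "polyseq_upto d i f \<Longrightarrow> f \<in> UNIV \<rightarrow> carrier G"
  using polyseq_upto_in U_closed by blast

lemma polyseq_upto_SucD: "polyseq_upto (Suc d) i f \<Longrightarrow> polyseq_upto d i f"
proof (induction d arbitrary: i f)
  case (Suc d)
  then show ?case using polyseq_upto.simps(2) by blast
qed simp

lemma polyseq_upto_antimono: "\<lbrakk>polyseq_upto d j f; i \<le> j\<rbrakk> \<Longrightarrow> polyseq_upto d i f"
proof (induction d arbitrary: i j f)
  case 0
  then show ?case using U_antimono by auto
next
  case (Suc d)
  then show ?case using U_antimono[of i j] Suc.IH[of "Suc j" "diff f" "Suc i"] by auto
qed

lemma polyseq_upto_shift: "polyseq_upto d i f \<Longrightarrow> polyseq_upto d i (\<lambda>n. f (Suc n))"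
proof (induction d arbitrary: i f)
  case (Suc d)
  have "diff (\<lambda>n. f (Suc n)) = (\<lambda>n. diff f (Suc n))" by (simp add: diff_def fun_eq_iff)
  then show ?case using Suc by simp
qed simp

lemma polyseq_upto_one: "polyseq_upto d i (\<lambda>n. \<one>)"
  by (induction d arbitrary: i) (simp_all add: subgroup.one_closed[OF U_subgroup] diff_const)

text \<open>The two claims need each other: by \<open>diff_mult\<close> the difference of a product
  contains a commutator, and by \<open>diff_commutator\<close> the difference of a commutator is a
  product of commutators. All these factors lie at least at the required level.\<close>

lemma polyseq_upto_mult_commutator:
  shows "\<lbrakk>polyseq_upto d i f; polyseq_upto d i g\<rbrakk> \<Longrightarrow> polyseq_upto d i (\<lambda>n. f n \<otimes> g n)"
    and "\<lbrakk>polyseq_upto d i f; polyseq_upto d j g\<rbrakk> \<Longrightarrow> polyseq_upto d (Suc (i + j)) (\<lambda>n. commutator (f n) (g n))"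
proof (induction d arbitrary: i j f g)
  case 0
  { case 1 then show ?case by (simp add: subgroup.m_closed[OF U_subgroup]) }
  { case 2 then show ?case by (simp add: U_commutator) }
next
  case (Suc d)
  note mult = Suc.IH(1) and comm = Suc.IH(2)
  {
    case 1
    then have fg: "polyseq_upto d (Suc i) (diff f)" "polyseq_upto d (Suc i) (diff g)" by auto
    have "polyseq_upto d (Suc (i + Suc i)) (\<lambda>n. commutator (f n) (diff g n))"
      by (rule comm[OF polyseq_upto_SucD[OF 1(1)] fg(2)])
    then have "polyseq_upto d (Suc i) (\<lambda>n. commutator (f n) (diff g n))"
      by (rule polyseq_upto_antimono) simp
    then have "polyseq_upto d (Suc i) (diff (\<lambda>n. f n \<otimes> g n))"
      unfolding diff_mult[OF polyseq_upto_Pi[OF 1(1)] polyseq_upto_Pi[OF 1(2)]]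
      by (intro mult fg)
    then show ?case
      using 1 by (simp add: subgroup.m_closed[OF U_subgroup])
  next
    case 2
    have f: "polyseq_upto d i f" and f': "polyseq_upto d (Suc i) (diff f)" using 2 polyseq_upto_SucD by auto
    have g: "polyseq_upto d j g" and g': "polyseq_upto d (Suc j) (diff g)" using 2 polyseq_upto_SucD by auto
    have G: "polyseq_upto d j (\<lambda>n. g (Suc n))" using g by (rule polyseq_upto_shift)
    have c: "polyseq_upto d (Suc (i + j)) (\<lambda>n. commutator (f n) (g n))"
      "polyseq_upto d (Suc (i + j)) (\<lambda>n. commutator (f n) (g (Suc n)))"
      "polyseq_upto d (Suc (Suc i + j)) (\<lambda>n. commutator (diff f n) (g (Suc n)))"
      "polyseq_upto d (Suc (i + Suc j)) (\<lambda>n. commutator (f n) (diff g n))"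
      by (intro comm f g f' g' G)+
    have "polyseq_upto d (Suc (Suc (i + j))) (\<lambda>n. commutator (diff f n) (commutator (f n) (g (Suc n))))"
      by (rule polyseq_upto_antimono[OF comm[OF f' c(2)]]) simp
    moreover have "polyseq_upto d (Suc (Suc (i + j))) (\<lambda>n. commutator (diff g n) (commutator (f n) (g n)))"
      by (rule polyseq_upto_antimono[OF comm[OF g' c(1)]]) simp
    moreover have "polyseq_upto d (Suc (Suc (i + j)))
        (\<lambda>n. commutator (commutator (f n) (g n)) (commutator (diff f n) (g (Suc n))))"
      by (rule polyseq_upto_antimono[OF comm[OF c(1) c(3)]]) simp
    ultimately have "polyseq_upto d (Suc (Suc (i + j))) (diff (\<lambda>n. commutator (f n) (g n)))"
      unfolding diff_commutator[OF polyseq_upto_Pi[OF 2(1)] polyseq_upto_Pi[OF 2(2)]]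
      using c(3,4) by (intro mult) simp_all
    then show ?case
      using 2 by (simp add: U_commutator)
  }
qed

lemmas polyseq_upto_mult = polyseq_upto_mult_commutator(1) and polyseq_upto_commutator = polyseq_upto_mult_commutator(2)

text \<open>Each difference lowers \<open>m\<close> by one while the required level rises by one, so
  \<open>i + m\<close> does not change.\<close>

lemma polyseq_upto_pow_choose: "b \<in> U (i + m) \<Longrightarrow> polyseq_upto d i (\<lambda>n. b [^] (n choose m))"
proof (induction d arbitrary: i m)
  case 0
  then have "b \<in> U i" using U_antimono[of i "i + m"] by auto
  then show ?case by (simp add: subgroup_nat_pow_closed[OF U_subgroup])
next
  case (Suc d)
  then have b: "b \<in> U i" "b \<in> carrier G" using U_antimono[of i "i + m"] U_closed by auto
  have "polyseq_upto d (Suc i) (diff (\<lambda>n. b [^] (n choose m)))"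
  proof (cases m)
    case 0
    then show ?thesis using b by (simp add: diff_const polyseq_upto_one)
  next
    case (Suc m')
    then show ?thesis using b Suc.IH[of "Suc i" m'] Suc.prems by (simp add: diff_pow_choose)
  qed
  then show ?case using b by (simp add: subgroup_nat_pow_closed[OF U_subgroup])
qed

lemma polyseq_upto_diffs: "polyseq_upto (k + d) i f \<Longrightarrow> polyseq_upto d (i + k) ((diff ^^ k) f)"
proof (induction k arbitrary: i f)
  case (Suc k)
  then show ?case using Suc.IH[of "Suc i" "diff f"] by (simp add: funpow_Suc_right del: funpow.simps(2))
qed simp

definition polyseq :: "nat \<Rightarrow> (nat \<Rightarrow> 'a) \<Rightarrow> bool" where
  "polyseq i f \<longleftrightarrow> (\<forall>d. polyseq_upto d i f)"

lemma polyseqI: "\<lbrakk>\<And>n. f n \<in> U i; polyseq (Suc i) (diff f)\<rbrakk> \<Longrightarrow> polyseq i f"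
  unfolding polyseq_def
proof
  fix d assume "f n \<in> U i" "\<forall>d. polyseq_upto d (Suc i) (diff f)" for n
  then show "polyseq_upto d i f" by (cases d) auto
qed

lemma polyseq_diff: "polyseq i f \<Longrightarrow> polyseq (Suc i) (diff f)"
  unfolding polyseq_def using polyseq_upto.simps(2) by blast

lemma polyseq_Pi: "polyseq i f \<Longrightarrow> f \<in> UNIV \<rightarrow> carrier G"
  unfolding polyseq_def using polyseq_upto_Pi by blast

lemma polyseq_antimono: "\<lbrakk>polyseq j f; i \<le> j\<rbrakk> \<Longrightarrow> polyseq i f"
  unfolding polyseq_def using polyseq_upto_antimono by blast

lemma polyseq_mult: "\<lbrakk>polyseq i f; polyseq i g\<rbrakk> \<Longrightarrow> polyseq i (\<lambda>n. f n \<otimes> g n)"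
  unfolding polyseq_def using polyseq_upto_mult by blast

lemma polyseq_commutator:
  "\<lbrakk>polyseq i f; polyseq j g\<rbrakk> \<Longrightarrow> polyseq (Suc (i + j)) (\<lambda>n. commutator (f n) (g n))"
  unfolding polyseq_def using polyseq_upto_commutator by blast

lemma polyseq_pow_choose: "b \<in> U (i + m) \<Longrightarrow> polyseq i (\<lambda>n. b [^] (n choose m))"
  unfolding polyseq_def using polyseq_upto_pow_choose by blast

lemma polyseq_pow: "b \<in> U (Suc i) \<Longrightarrow> polyseq i (\<lambda>n. b [^] n)"
  using polyseq_pow_choose[of b i 1] by simp

lemma polyseq_diffs_in: "polyseq i f \<Longrightarrow> (diff ^^ k) f n \<in> U (i + k)"
  using polyseq_upto_diffs[of k 0 i f] by (simp add: polyseq_def)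

text \<open>The commutator in the product rule \<open>diff_mult\<close> gains two levels, which makes the
  top difference multiplicative.\<close>

lemma diffs_mult:
  assumes "polyseq i f" "polyseq i g" "U (Suc (i + k)) = {\<one>}"
  shows "(diff ^^ k) (\<lambda>n. f n \<otimes> g n) n = (diff ^^ k) f n \<otimes> (diff ^^ k) g n"
  using assms
proof (induction k arbitrary: i f g)
  case (Suc k)
  let ?c = "\<lambda>n. commutator (f n) (diff g n)"
  have f': "polyseq (Suc i) (diff f)" and g': "polyseq (Suc i) (diff g)"
    using Suc.prems polyseq_diff by auto
  have "polyseq (Suc (i + Suc i)) ?c" by (rule polyseq_commutator[OF Suc.prems(1) g'])
  then have c: "polyseq (Suc (Suc i)) ?c" by (rule polyseq_antimono) simp
  then have c': "polyseq (Suc i) ?c" by (rule polyseq_antimono) simp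
  have U: "U (Suc (Suc i + k)) = {\<one>}" using Suc.prems by simp
  have c1: "(diff ^^ k) ?c n = \<one>"
    using polyseq_diffs_in[OF c, of k n] U by simp
  have [simp]: "(diff ^^ k) (diff g) n \<in> carrier G"
    using polyseq_diffs_in[OF g'] U_closed by blast
  have "(diff ^^ k) (\<lambda>n. diff f n \<otimes> (?c n \<otimes> diff g n)) n
      = (diff ^^ k) (diff f) n \<otimes> (diff ^^ k) (diff g) n"
    using Suc.IH[OF f' polyseq_mult[OF c' g'] U] Suc.IH[OF c' g' U] by (simp add: c1)
  then show ?case
    using Suc.prems polyseq_Pi[of i]
    by (simp add: funpow_Suc_right diff_mult del: funpow.simps(2))
qed simp

text \<open>Dividing out the Taylor factor \<open>f m [^] (n choose m)\<close> makes the sequence vanish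
  at one more point; a sequence with enough zeros is trivial because its differences of high order
  are.\<close>

lemma power_formula_step:
  assumes f: "polyseq i f" and zero: "\<And>j. j < m \<Longrightarrow> f j = \<one>"
  shows "\<exists>g. polyseq i g \<and> (\<forall>j\<le>m. g j = \<one>) \<and> f m \<in> U (i + m) \<and>
    (\<forall>n. f n = f m [^] (n choose m) \<otimes> g n) \<and>
    (\<forall>k>m. U (Suc (i + k)) = {\<one>} \<longrightarrow> (diff ^^ k) g 0 = (diff ^^ k) f 0)"
proof -
  define b where "b = f m"
  have Pi: "f \<in> UNIV \<rightarrow> carrier G" using f by (rule polyseq_Pi)
  \<comment> \<open>The earlier values are trivial, so \<open>f m\<close> is the \<open>m\<close>-th
    difference at 0.\<close>
  have bU: "b \<in> U (i + m)"
    using diffs_initial_zeros[OF Pi zero, of m 0 m] polyseq_diffs_in[OF f, of m 0] by (simp add: b_def)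
  have [simp]: "b \<in> carrier G" "f n \<in> carrier G" for n using Pi by (auto simp: b_def)
  define g where "g = (\<lambda>n. inv b [^] (n choose m) \<otimes> f n)"
  have inv: "polyseq i (\<lambda>n. inv b [^] (n choose m))"
    by (rule polyseq_pow_choose) (rule subgroup.m_inv_closed[OF U_subgroup bU])
  have "polyseq i g" unfolding g_def by (rule polyseq_mult[OF inv f])
  moreover have "g j = \<one>" if "j \<le> m" for j
    using that zero[of j] by (cases "j = m") (simp_all add: g_def binomial_eq_0 flip: b_def)
  moreover have "f n = b [^] (n choose m) \<otimes> g n" for n
    by (simp add: g_def mult_inv_cancel nat_pow_inv)
  \<comment> \<open>The Taylor factor has degree \<open>m < k\<close>, so its \<open>k\<close>-th
    difference is trivial; \<open>diffs_mult\<close> splits it off because \<open>k\<close>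
    differences reach the top level.\<close>
  moreover have "(diff ^^ k) g 0 = (diff ^^ k) f 0" if "m < k" "U (Suc (i + k)) = {\<one>}" for k
  proof -
    have "(diff ^^ k) f 0 \<in> carrier G" using diffs_Pi[OF Pi] by blast
    then show ?thesis
      unfolding g_def diffs_mult[OF inv f that(2)] using that(1) by (simp add: diffs_pow_choose)
  qed
  ultimately show ?thesis using bU unfolding b_def by blast
qed

text \<open>Evaluate the Taylor expansion of \<open>f\<close> at \<open>q\<close>. The term of order
  0 is \<open>f 0\<close>. For orders from 2 to \<open>p - 1\<close> the coefficient lies in
  \<open>U (i + 2)\<close> and the exponent is a multiple of \<open>q\<close>. Orders above
  \<open>p\<close> vanish by \<open>U\<close>. Only orders 1 and \<open>p\<close> remain, and the
  coefficient of order \<open>p\<close> is the \<open>p\<close>-th difference at 0.\<close>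

theorem power_formula:
  fixes p e :: nat
  assumes p: "Factorial_Ring.prime p" and q: "q = p ^ e"
    and f: "polyseq i f" "f 0 = \<one>"
    and exp: "\<And>x. x \<in> U (i + 2) \<Longrightarrow> x [^] q = \<one>"
    and U: "U (Suc (i + p)) = {\<one>}"
  shows "f q = f 1 [^] q \<otimes> ((diff ^^ p) f 0) [^] (q choose p)"
proof -
  have [simp]: "f n \<in> carrier G" for n using polyseq_Pi[OF f(1)] by auto
  \<comment> \<open>Here \<open>g\<close> is what remains after the factors of orders 1 to
    \<open>m\<close> have been divided out. Among these factors only the first contributes to the
    value at \<open>q\<close>.\<close>
  have "\<exists>g. polyseq i g \<and> (\<forall>j\<le>m. g j = \<one>) \<and> f q = f 1 [^] q \<otimes> g q \<and> (diff ^^ p) g 0 = (diff ^^ p) f 0"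
    if "1 \<le> m" "m < p" for m
    using that
  proof (induction m rule: nat_induct_at_least)
    case base
    have "f j = \<one>" if "j < 1" for j using that f(2) by simp
    then obtain g where "polyseq i g" "\<forall>j\<le>1. g j = \<one>" "f q = f 1 [^] (q choose 1) \<otimes> g q"
        "(diff ^^ p) g 0 = (diff ^^ p) f 0"
      using power_formula_step[OF f(1), of 1] U base by metis
    then show ?case by (metis choose_one)
  next
    case (Suc m)
    then obtain g where g: "polyseq i g" "\<And>j. j \<le> m \<Longrightarrow> g j = \<one>" "f q = f 1 [^] q \<otimes> g q"
      "(diff ^^ p) g 0 = (diff ^^ p) f 0" by auto
    then have "g j = \<one>" if "j < Suc m" for j using that by simp
    from power_formula_step[OF g(1) this]
    obtain h where h: "polyseq i h" "\<forall>j\<le>Suc m. h j = \<one>" "g (Suc m) \<in> U (i + Suc m)"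
      "g q = g (Suc m) [^] (q choose Suc m) \<otimes> h q" "(diff ^^ p) h 0 = (diff ^^ p) g 0"
      using U Suc.prems(1) by metis
    have "h q \<in> carrier G" using polyseq_Pi[OF h(1)] by auto
    moreover have "g (Suc m) [^] (q choose Suc m) = \<one>"
    proof (rule pow_eq_one_dvd)
      show "g (Suc m) \<in> carrier G" using h(3) U_closed by blast
      show "g (Suc m) [^] q = \<one>"
        using h(3) Suc.hyps U_antimono[of "i + 2" "i + Suc m"] by (auto intro!: exp)
      show "q dvd (q choose Suc m)"
        unfolding q using Suc.prems by (intro prime_power_dvd_binomial[OF p]) auto
    qed
    ultimately have "g q = h q" using h(4) by (metis l_one)
    then show ?case using g(3,4) h(1,2,5) by metis
  qed
  moreover have "1 \<le> p - 1" "p - 1 < p" "\<And>j. j < p \<longleftrightarrow> j \<le> p - 1"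
    using prime_gt_1_nat[OF p] by auto
  ultimately obtain g where g: "polyseq i g" "\<And>j. j < p \<Longrightarrow> g j = \<one>"
      "f q = f 1 [^] q \<otimes> g q" "(diff ^^ p) g 0 = (diff ^^ p) f 0"
    by metis
  from power_formula_step[OF g(1,2)]
  obtain h where h: "polyseq i h" "\<And>j. j \<le> p \<Longrightarrow> h j = \<one>"
      "\<And>n. g n = g p [^] (n choose p) \<otimes> h n" by blast
  have gp: "g p = (diff ^^ p) f 0"
    using diffs_initial_zeros[OF polyseq_Pi[OF g(1)] g(2), of p 0 p] g(4) by simp
  \<comment> \<open>Descending induction on the order of the difference. Order \<open>p + 1\<close>
    lies in a trivial level. If the difference of \<open>D\<close> is trivial then \<open>D\<close>
    is constant, and \<open>D 0\<close> is trivial because \<open>h\<close> vanishes on 0, ...,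
    \<open>p\<close>.\<close>
  have "(diff ^^ (Suc p - k)) h n = \<one>" if "k \<le> Suc p" for k n
    using that
  proof (induction k arbitrary: n)
    case 0
    then show ?case using polyseq_diffs_in[OF h(1), of "Suc p" n] U by simp
  next
    case (Suc k)
    define D where "D = (diff ^^ (Suc p - Suc k)) h"
    have D: "D n \<in> carrier G" for n
      using diffs_Pi[OF polyseq_Pi[OF h(1)]] unfolding D_def by blast
    have "Suc p - k = Suc (Suc p - Suc k)" using Suc.prems by simp
    then have "diff D n = \<one>" for n
      using Suc.IH[of n] Suc.prems unfolding D_def by simp
    then have step: "D (Suc n) = D n" for n
      using D inv_equality by (metis diff_def inv_inv inv_closed)
    have "D 0 = \<one>"
      using diffs_initial_zeros[OF polyseq_Pi[OF h(1)], of "Suc p" 0 "Suc p - Suc k"] h(2)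
      unfolding D_def by auto
    then have "D n = \<one>" by (induction n) (simp_all add: step)
    then show ?case by (simp add: D_def)
  qed
  from this[of "Suc p" q] have "h q = \<one>" by simp
  moreover have "g p \<in> carrier G" using polyseq_Pi[OF g(1)] by auto
  ultimately have "g q = g p [^] (q choose p)" using h(3)[of q] by (metis nat_pow_closed r_one)
  then show ?thesis using g(3) gp by metis
qed

end

section \<open>Differences in abelian groups\<close>

context comm_group
begin

lemma diff_mult_comm:
  assumes "f \<in> UNIV \<rightarrow> carrier G" "g \<in> UNIV \<rightarrow> carrier G"
  shows "diff (\<lambda>n. f n \<otimes> g n) = (\<lambda>n. diff f n \<otimes> diff g n)"
proof
  fix n
  have [simp]: "f k \<in> carrier G" "g k \<in> carrier G" for k using assms by auto
  show "diff (\<lambda>n. f n \<otimes> g n) n = diff f n \<otimes> diff g n"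
    by (simp add: diff_def inv_mult m_ac)
qed

lemma diffs_mult_comm:
  assumes "f \<in> UNIV \<rightarrow> carrier G" "g \<in> UNIV \<rightarrow> carrier G"
  shows "(diff ^^ k) (\<lambda>n. f n \<otimes> g n) = (\<lambda>n. (diff ^^ k) f n \<otimes> (diff ^^ k) g n)"
  using assms
proof (induction k)
  case (Suc k)
  then show ?case by (simp add: diff_mult_comm del: Pi_iff)
qed simp

text \<open>In additive notation, the Leibniz rule for the product of \<open>f n\<close> with
  \<open>n\<close>. As \<open>n\<close> has constant difference 1, only two terms survive.\<close>

lemma diffs_power_index:
  assumes "f \<in> UNIV \<rightarrow> carrier G"
  shows "(diff ^^ Suc k) (\<lambda>n. f n [^] n) =
    (\<lambda>n. ((diff ^^ k) f (Suc n)) [^] Suc k \<otimes> ((diff ^^ Suc k) f n) [^] n)"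
  using assms
proof (induction k arbitrary: f)
  case 0
  then have "f n \<in> carrier G" for n by auto
  then show ?case
    by (simp add: diff_def fun_eq_iff nat_pow_distrib nat_pow_inv m_ac)
next
  case (Suc k)
  have [simp]: "f n \<in> carrier G" "(diff ^^ j) f n \<in> carrier G" "diff f n \<in> carrier G" for n j
    using Suc.prems diffs_Pi[OF Suc.prems, of j] diff_closed[OF Suc.prems] by (auto simp del: diffs_Pi)
  have shift: "(diff ^^ j) (\<lambda>n. f (Suc n)) = (\<lambda>n. (diff ^^ j) f (Suc n))" for j
    by (induction j) (simp_all add: diff_def)
  have "diff (\<lambda>n. f n [^] n) = (\<lambda>n. f (Suc n) \<otimes> diff f n [^] n)"
    by (simp add: diff_def fun_eq_iff nat_pow_distrib nat_pow_inv m_ac)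
  then have "(diff ^^ Suc (Suc k)) (\<lambda>n. f n [^] n)
      = (diff ^^ Suc k) (\<lambda>n. f (Suc n) \<otimes> diff f n [^] n)"
    by (simp only: funpow_Suc_right o_apply)
  also have "\<dots> = (\<lambda>n. (diff ^^ Suc k) f (Suc n) \<otimes>
      (((diff ^^ k) (diff f) (Suc n)) [^] Suc k \<otimes> ((diff ^^ Suc k) (diff f) n) [^] n))"
    using Suc.IH[OF diff_Pi[OF Suc.prems]]
    by (subst diffs_mult_comm) (auto simp add: shift simp del: funpow.simps)
  also have "\<dots> = (\<lambda>n. ((diff ^^ Suc k) f (Suc n)) [^] Suc (Suc k) \<otimes> ((diff ^^ Suc (Suc k)) f n) [^] n)"
  proof -
    have "diff ((diff ^^ k) f) (Suc n) \<in> carrier G" for n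
      using \<open>\<And>j n. (diff ^^ j) f n \<in> carrier G\<close>[of "Suc k"] by simp
    then show ?thesis
      by (simp add: m_ac flip: funpow_swap1)
  qed
  finally show ?case .
qed

end

section \<open>Tensor pairings\<close>

text \<open>An abstraction of the nonabelian tensor square: \<open>w\<close> is the symbol,
  \<open>act\<close> the diagonal conjugation action and \<open>d\<close> the commutator map. The
  defining relations are expressed through \<open>act\<close>, and \<open>generate_w\<close> reduces
  identities to symbols.\<close>

locale tensor_pairing = group L + G: group G
  for L :: "('l, 'm) monoid_scheme" (structure) and G :: "('g, 'h) monoid_scheme" +
  fixes act :: "'g \<Rightarrow> 'l \<Rightarrow> 'l" and d :: "'l \<Rightarrow> 'g" and w :: "'g \<Rightarrow> 'g \<Rightarrow> 'l"
  assumes act_hom: "g \<in> carrier G \<Longrightarrow> act g \<in> hom L L"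
    and act_mult: "\<lbrakk>g \<in> carrier G; h \<in> carrier G; t \<in> carrier L\<rbrakk>
      \<Longrightarrow> act (g \<otimes>\<^bsub>G\<^esub> h) t = act g (act h t)"
    and act_one [simp]: "t \<in> carrier L \<Longrightarrow> act \<one>\<^bsub>G\<^esub> t = t"
    and d_hom: "d \<in> hom L G"
    and w_closed [simp]: "\<lbrakk>g \<in> carrier G; h \<in> carrier G\<rbrakk> \<Longrightarrow> w g h \<in> carrier L"
    and w_mult_left: "\<lbrakk>g \<in> carrier G; g' \<in> carrier G; h \<in> carrier G\<rbrakk>
      \<Longrightarrow> w (g \<otimes>\<^bsub>G\<^esub> g') h = act g (w g' h) \<otimes> w g h"
    and w_mult_right: "\<lbrakk>g \<in> carrier G; h \<in> carrier G; h' \<in> carrier G\<rbrakk>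
      \<Longrightarrow> w g (h \<otimes>\<^bsub>G\<^esub> h') = w g h \<otimes> act h (w g h')"
    and act_w: "\<lbrakk>k \<in> carrier G; g \<in> carrier G; h \<in> carrier G\<rbrakk>
      \<Longrightarrow> act k (w g h) = w (conj_by G k g) (conj_by G k h)"
    and d_w: "\<lbrakk>g \<in> carrier G; h \<in> carrier G\<rbrakk> \<Longrightarrow> d (w g h) = G.commutator g h"
    and generate_w: "carrier L \<subseteq> generate L (case_prod w ` (carrier G \<times> carrier G))"
begin

lemma act_closed [simp]: "\<lbrakk>g \<in> carrier G; t \<in> carrier L\<rbrakk> \<Longrightarrow> act g t \<in> carrier L"
  by (rule hom_in_carrier[OF act_hom])

lemma act_distrib: "\<lbrakk>g \<in> carrier G; s \<in> carrier L; t \<in> carrier L\<rbrakk> \<Longrightarrow> act g (s \<otimes> t) = act g s \<otimes> act g t"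
  by (rule hom_mult[OF act_hom])

lemma act_group_hom: "g \<in> carrier G \<Longrightarrow> group_hom L L (act g)"
  by (simp add: group_hom_def group_hom_axioms_def act_hom group_axioms)

lemma act_inv: "\<lbrakk>g \<in> carrier G; t \<in> carrier L\<rbrakk> \<Longrightarrow> act g (inv t) = inv (act g t)"
  and act_unit [simp]: "g \<in> carrier G \<Longrightarrow> act g \<one> = \<one>"
  by (simp_all add: group_hom.hom_inv[OF act_group_hom] group_hom.hom_one[OF act_group_hom])

lemma act_inv_cancel [simp]:
  assumes "g \<in> carrier G" "t \<in> carrier L"
  shows "act g (act (inv\<^bsub>G\<^esub> g) t) = t" "act (inv\<^bsub>G\<^esub> g) (act g t) = t"
  using act_mult[of g "inv\<^bsub>G\<^esub> g" t] act_mult[of "inv\<^bsub>G\<^esub> g" g t] assms by simp_all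

sublocale d: group_hom L G d
  by (simp add: group_hom_def group_hom_axioms_def d_hom group_axioms G.group_axioms)

lemma L_induct [consumes 1, case_names w one inv mult]:
  assumes "t \<in> carrier L"
    and "\<And>g h. \<lbrakk>g \<in> carrier G; h \<in> carrier G\<rbrakk> \<Longrightarrow> P (w g h)"
    and "P \<one>"
    and "\<And>t. \<lbrakk>t \<in> carrier L; P t\<rbrakk> \<Longrightarrow> P (inv t)"
    and "\<And>s t. \<lbrakk>s \<in> carrier L; t \<in> carrier L; P s; P t\<rbrakk> \<Longrightarrow> P (s \<otimes> t)"
  shows "P t"
proof -
  have "t \<in> generate L (case_prod w ` (carrier G \<times> carrier G))"
    by (rule subsetD[OF generate_w assms(1)])
  then have "t \<in> carrier L \<and> P t"
    by (induction rule: generate.induct) (use assms in auto)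
  then show ?thesis by simp
qed

section \<open>The map \<open>d\<close> as a crossed module over \<open>G\<close>\<close>

lemma d_act:
  assumes g: "g \<in> carrier G" and "t \<in> carrier L"
  shows "d (act g t) = conj_by G g (d t)"
  using assms(2)
proof (induction rule: L_induct)
  case (w a b)
  then show ?case using g by (simp add: act_w d_w conj_by_def G.commutator_def G.word_simps)
next
  case one
  show ?case using g by (simp add: conj_by_def)
next
  case (inv t)
  then show ?case using g by (simp add: act_inv conj_by_def G.word_simps)
next
  case (mult s t)
  then show ?case using g by (simp add: act_distrib conj_by_def G.word_simps)
qed

text \<open>Comparing the two expansions of \<open>w (g g') (h h')\<close>.\<close>

lemma peiffer_generators:
  assumes [simp]: "g \<in> carrier G" "g' \<in> carrier G" "h \<in> carrier G" "h' \<in> carrier G"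
  shows "act (g \<otimes>\<^bsub>G\<^esub> h) (w g' h') \<otimes> w g h = w g h \<otimes> act (h \<otimes>\<^bsub>G\<^esub> g) (w g' h')"
proof -
  have "w (g \<otimes>\<^bsub>G\<^esub> g') (h \<otimes>\<^bsub>G\<^esub> h')
      = act g (w g' h) \<otimes> (act (g \<otimes>\<^bsub>G\<^esub> h) (w g' h') \<otimes> w g h \<otimes> act h (w g h'))"
    by (subst w_mult_left) (simp_all add: w_mult_right act_distrib act_mult m_assoc)
  moreover have "w (g \<otimes>\<^bsub>G\<^esub> g') (h \<otimes>\<^bsub>G\<^esub> h')
      = act g (w g' h) \<otimes> (w g h \<otimes> act (h \<otimes>\<^bsub>G\<^esub> g) (w g' h') \<otimes> act h (w g h'))"
    by (simp add: w_mult_right[of _ h] w_mult_left act_distrib act_mult m_assoc)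
  ultimately show ?thesis by simp
qed

text \<open>Translating the argument of \<open>peiffer_generators\<close> by the inverse of
  \<open>h g\<close> turns \<open>g h\<close> into the commutator of \<open>g\<close> and
  \<open>h\<close>, and \<open>h g\<close> into the identity.\<close>

lemma peiffer_w:
  assumes gh [simp]: "g \<in> carrier G" "h \<in> carrier G" and s: "s \<in> carrier L"
  shows "act (G.commutator g h) s = w g h \<otimes> s \<otimes> inv w g h"
  using s
proof (induction rule: L_induct)
  case (w a b)
  let ?k = "inv\<^bsub>G\<^esub> (h \<otimes>\<^bsub>G\<^esub> g)"
  define s where "s = w (conj_by G ?k a) (conj_by G ?k b)"
  have s: "s = act ?k (w a b)" using w by (simp add: s_def act_w)
  have 1: "act (h \<otimes>\<^bsub>G\<^esub> g) s = w a b" unfolding s using w by (intro act_inv_cancel) auto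
  have "g \<otimes>\<^bsub>G\<^esub> h \<otimes>\<^bsub>G\<^esub> ?k = G.commutator g h"
    by (simp add: G.commutator_def G.word_simps)
  then have 2: "act (g \<otimes>\<^bsub>G\<^esub> h) s = act (G.commutator g h) (w a b)"
    unfolding s using w act_mult[of "g \<otimes>\<^bsub>G\<^esub> h" ?k "w a b"] by simp
  have "act (g \<otimes>\<^bsub>G\<^esub> h) s \<otimes> w g h = w g h \<otimes> act (h \<otimes>\<^bsub>G\<^esub> g) s"
    unfolding s_def using w by (intro peiffer_generators) auto
  then show ?case unfolding 1 2 using w by (intro conj_eqI) auto
next
  case one
  show ?case by simp
next
  case (inv t)
  then show ?case by (simp add: act_inv word_simps)
next
  case (mult s t)
  then show ?case by (simp add: act_distrib word_simps)
qed

text \<open>The second axiom of a crossed module, extended from symbols to all of \<open>L\<close>.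
  It makes the kernel of \<open>d\<close> central and turns commutators in \<open>L\<close> into
  instances of the action.\<close>

lemma peiffer:
  assumes "t \<in> carrier L" and s: "s \<in> carrier L"
  shows "act (d t) s = t \<otimes> s \<otimes> inv t"
  using assms
proof (induction arbitrary: s rule: L_induct)
  case (w g h)
  then show ?case by (simp add: d_w peiffer_w)
next
  case one
  then show ?case by simp
next
  case (inv t)
  have "act (d t) (inv t \<otimes> s \<otimes> t) = s"
    using inv by (simp add: word_simps)
  then show ?case using inv act_inv_cancel(2)[of "d t" "inv t \<otimes> s \<otimes> t"] by simp
next
  case (mult t u)
  then show ?case by (simp add: act_mult word_simps)
qed

lemma w_one_right [simp]: "g \<in> carrier G \<Longrightarrow> w g \<one>\<^bsub>G\<^esub> = \<one>"
  using w_mult_right[of g "\<one>\<^bsub>G\<^esub>" "\<one>\<^bsub>G\<^esub>"] by simp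

lemma w_one_left [simp]: "g \<in> carrier G \<Longrightarrow> w \<one>\<^bsub>G\<^esub> g = \<one>"
  using w_mult_left[of "\<one>\<^bsub>G\<^esub>" "\<one>\<^bsub>G\<^esub>" g] by simp

lemma w_inv_right:
  assumes [simp]: "g \<in> carrier G" "h \<in> carrier G"
  shows "w g (inv\<^bsub>G\<^esub> h) = inv (act (inv\<^bsub>G\<^esub> h) (w g h))"
proof -
  have "w g (inv\<^bsub>G\<^esub> h) \<otimes> act (inv\<^bsub>G\<^esub> h) (w g h) = \<one>"
    using w_mult_right[of g "inv\<^bsub>G\<^esub> h" h] by simp
  then show ?thesis by (intro inv_equality[symmetric]) simp_all
qed

text \<open>The two factorizations \<open>g h = h (h^-1 g h)\<close> are expanded in the first
  argument, and \<open>h k h^-1 = [h, k] k\<close> in the second; \<open>peiffer_w\<close> resolves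
  the remaining action of \<open>[h, k]\<close>.\<close>

lemma w_d_right_generators:
  assumes [simp]: "g \<in> carrier G" "h \<in> carrier G" "k \<in> carrier G"
  shows "w g (G.commutator h k) = act g (w h k) \<otimes> inv (w h k)"
proof -
  let ?m = "conj_by G h k"
  have conj: "conj_by G h (inv\<^bsub>G\<^esub> h \<otimes>\<^bsub>G\<^esub> g \<otimes>\<^bsub>G\<^esub> h) = g"
    by (simp add: conj_by_def G.word_simps)
  have "w (h \<otimes>\<^bsub>G\<^esub> (inv\<^bsub>G\<^esub> h \<otimes>\<^bsub>G\<^esub> g \<otimes>\<^bsub>G\<^esub> h)) k = w g ?m \<otimes> w h k"
    by (subst w_mult_left) (simp_all add: act_w conj)
  then have 1: "act g (w h k) \<otimes> w g k = w g ?m \<otimes> w h k"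
    by (simp add: G.word_simps w_mult_left)
  have "G.commutator h k \<otimes>\<^bsub>G\<^esub> k = ?m"
    by (simp add: G.commutator_def conj_by_def G.word_simps)
  then have "w g ?m = w g (G.commutator h k) \<otimes> act (G.commutator h k) (w g k)"
    using w_mult_right[of g "G.commutator h k" k] by simp
  also have "act (G.commutator h k) (w g k) = w h k \<otimes> w g k \<otimes> inv (w h k)"
    by (simp add: peiffer_w)
  finally have "act g (w h k) \<otimes> w g k = w g (G.commutator h k) \<otimes> (w h k \<otimes> w g k)"
    using 1 by (simp add: m_assoc)
  then have "act g (w h k) = w g (G.commutator h k) \<otimes> w h k"
    by (simp flip: m_assoc)
  then show ?thesis by (simp add: m_assoc)
qed

text \<open>The action moves \<open>t\<close> by the tensor of \<open>g\<close> with
  \<open>d t\<close>. In particular \<open>G\<close> fixes the kernel of \<open>d\<close>, which is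
  what ends the filtration. The steps for inverses and products rest on
  \<open>peiffer\<close>.\<close>

lemma w_d_right:
  assumes g [simp]: "g \<in> carrier G" and "t \<in> carrier L"
  shows "w g (d t) = act g t \<otimes> inv t"
  using assms(2)
proof (induction rule: L_induct)
  case (w a b)
  then show ?case by (simp add: d_w w_d_right_generators)
next
  case one
  then show ?case by simp
next
  case (inv t)
  then show ?case
    using peiffer[of "inv t" "act g t \<otimes> inv t"] by (simp add: w_inv_right act_inv word_simps)
next
  case (mult s t)
  then show ?case
    by (simp add: w_mult_right peiffer act_distrib word_simps)
qed

end

lemma (in group) subgroup_lower_central: "subgroup (lower_central G n) G"
proof (induction n)
  case 0
  then show ?case by (simp add: subgroup_self)
next
  case (Suc n)
  have "lower_central G n \<subseteq> carrier G" using subgroup.subset[OF Suc.IH] .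
  then show ?case unfolding lower_central.simps by (intro generate_is_subgroup) auto
qed

lemma (in group) lower_central_commutator:
  "\<lbrakk>x \<in> lower_central G n; g \<in> carrier G\<rbrakk> \<Longrightarrow> commutator x g \<in> lower_central G (Suc n)"
  by (auto simp: commutator_def intro!: generate.incl)

section \<open>The filtration by iterated \<open>delta\<close>\<close>

context tensor_pairing
begin

definition delta :: "'g \<Rightarrow> 'l \<Rightarrow> 'l" where
  "delta g t = act g t \<otimes> inv t"

lemma delta_closed [simp]: "\<lbrakk>g \<in> carrier G; t \<in> carrier L\<rbrakk> \<Longrightarrow> delta g t \<in> carrier L"
  by (simp add: delta_def)

lemma act_eq_delta: "\<lbrakk>g \<in> carrier G; t \<in> carrier L\<rbrakk> \<Longrightarrow> act g t = delta g t \<otimes> t"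
  by (simp add: delta_def word_simps)

lemma delta_mult:
  "\<lbrakk>g \<in> carrier G; s \<in> carrier L; t \<in> carrier L\<rbrakk>
    \<Longrightarrow> delta g (s \<otimes> t) = delta g s \<otimes> (commutator s (delta g t) \<otimes> delta g t)"
  by (simp add: delta_def commutator_def act_distrib word_simps)

lemma delta_mult_left:
  "\<lbrakk>g \<in> carrier G; h \<in> carrier G; t \<in> carrier L\<rbrakk>
    \<Longrightarrow> delta (g \<otimes>\<^bsub>G\<^esub> h) t = delta g (delta h t) \<otimes> (delta h t \<otimes> delta g t)"
  by (simp add: delta_def act_mult act_distrib act_inv word_simps)

lemma act_delta:
  "\<lbrakk>k \<in> carrier G; g \<in> carrier G; t \<in> carrier L\<rbrakk>
    \<Longrightarrow> act k (delta g t) = delta (conj_by G k g) (act k t)"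
  by (simp add: delta_def act_distrib act_inv act_mult conj_by_def)

lemma d_delta:
  assumes [simp]: "g \<in> carrier G" "t \<in> carrier L"
  shows "d (delta g t) = inv\<^bsub>G\<^esub> (G.commutator (d t) g)"
  by (simp add: delta_def d_act conj_by_def G.commutator_def G.word_simps)

lemma delta_trivial: "\<lbrakk>g \<in> carrier G; t \<in> carrier L; d t = \<one>\<^bsub>G\<^esub>\<rbrakk> \<Longrightarrow> delta g t = \<one>"
  using w_d_right[of g t] by (simp add: delta_def)

lemma delta_one [simp]: "g \<in> carrier G \<Longrightarrow> delta g \<one> = \<one>"
  by (simp add: delta_def)

text \<open>The numbering is chosen so that \<open>d\<close> maps level \<open>k\<close> into
  \<open>lower_central G k\<close>; levels 0 and 1 agree because \<open>d\<close> already takes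
  values in the commutator subgroup. The repeated level gives orbit products room to start one level
  above their first difference.\<close>

fun filtration :: "nat \<Rightarrow> 'l set" where
  "filtration 0 = carrier L"
| "filtration (Suc 0) = carrier L"
| "filtration (Suc (Suc k)) = generate L (case_prod delta ` (carrier G \<times> filtration (Suc k)))"

declare filtration.simps(3) [simp del]

lemma subgroup_filtration: "subgroup (filtration k) L"
proof (induction k rule: filtration.induct)
  case (3 k)
  then show ?case using subgroup.subset[OF 3]
    unfolding filtration.simps by (intro generate_is_subgroup) (auto simp: subset_iff)
qed (simp_all add: subgroup_self)

lemma filtration_closed: "t \<in> filtration k \<Longrightarrow> t \<in> carrier L"
  using subgroup.subset[OF subgroup_filtration] by auto

lemma delta_filtration: "\<lbrakk>g \<in> carrier G; t \<in> filtration (Suc k)\<rbrakk> \<Longrightarrow> delta g t \<in> filtration (Suc (Suc k))"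
  by (auto simp: filtration.simps(3) intro: generate.incl)

lemma filtration_least:
  assumes "subgroup H L" "\<And>g t. \<lbrakk>g \<in> carrier G; t \<in> filtration (Suc k)\<rbrakk> \<Longrightarrow> delta g t \<in> H"
  shows "filtration (Suc (Suc k)) \<subseteq> H"
  unfolding filtration.simps using assms by (intro generate_subgroup_incl) auto

lemma subgroup_hom_vimage:
  assumes "group_hom L M f" "subgroup H M"
  shows "subgroup {t \<in> carrier L. f t \<in> H} L"
proof -
  interpret f: group_hom L M f by (rule assms(1))
  show ?thesis
    by (intro subgroupI)
      (auto simp: subgroup.m_inv_closed[OF assms(2)] subgroup.m_closed[OF assms(2)]
        subgroup.one_closed[OF assms(2)] intro!: exI[of _ \<one>])
qed

lemma act_filtration: "\<lbrakk>g \<in> carrier G; t \<in> filtration k\<rbrakk> \<Longrightarrow> act g t \<in> filtration k"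
proof (induction k arbitrary: t rule: filtration.induct)
  case (3 k)
  have "filtration (Suc (Suc k)) \<subseteq> {t \<in> carrier L. act g t \<in> filtration (Suc (Suc k))}"
  proof (intro filtration_least subgroup_hom_vimage[OF act_group_hom subgroup_filtration])
    show "g \<in> carrier G" by (rule 3)
    fix h t assume "h \<in> carrier G" "t \<in> filtration (Suc k)"
    then show "delta h t \<in> {t \<in> carrier L. act g t \<in> filtration (Suc (Suc k))}"
      using 3 filtration_closed by (simp add: act_delta delta_filtration)
  qed
  then show ?case using 3 by blast
qed simp_all

lemma filtration_Suc: "filtration (Suc k) \<subseteq> filtration k"
proof (cases k)
  case (Suc j)
  have "delta g t \<in> filtration (Suc j)" if "g \<in> carrier G" "t \<in> filtration (Suc j)" for g t
    unfolding delta_def using that subgroup_filtration act_filtration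
    by (blast intro: subgroup.m_closed subgroup.m_inv_closed)
  then show ?thesis unfolding Suc by (intro filtration_least subgroup_filtration)
qed simp

text \<open>By \<open>d_delta\<close>, applying \<open>delta\<close> becomes taking a commutator
  with an element of \<open>G\<close>, which is one step down the lower central series.\<close>

lemma d_filtration: "t \<in> filtration k \<Longrightarrow> d t \<in> lower_central G k"
proof (induction k arbitrary: t rule: filtration.induct)
  case 2
  note lc = G.subgroup_lower_central[of "Suc 0"]
  from 2 have "t \<in> carrier L" by simp
  then show ?case
  proof (induction rule: L_induct)
    case (w g h)
    then show ?case using G.lower_central_commutator[of g 0 h] by (simp add: d_w del: lower_central.simps(2))
  qed (simp_all add: subgroup.one_closed[OF lc] subgroup.m_closed[OF lc] subgroup.m_inv_closed[OF lc]
      del: lower_central.simps)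
next
  case (3 k)
  note lc = G.subgroup_lower_central[of "Suc (Suc k)"]
  have "filtration (Suc (Suc k)) \<subseteq> {t \<in> carrier L. d t \<in> lower_central G (Suc (Suc k))}"
  proof (intro filtration_least subgroup_hom_vimage[OF d.group_hom_axioms lc])
    fix h t assume ht: "h \<in> carrier G" "t \<in> filtration (Suc k)"
    then have "G.commutator (d t) h \<in> lower_central G (Suc (Suc k))"
      using 3 by (intro G.lower_central_commutator)
    then show "delta h t \<in> {t \<in> carrier L. d t \<in> lower_central G (Suc (Suc k))}"
      using ht filtration_closed[OF ht(2)]
      by (simp add: d_delta subgroup.m_inv_closed[OF lc] del: lower_central.simps)
  qed
  then show ?case using 3 by blast
qed simp

text \<open>A three subgroups argument: modulo the target, \<open>act (x g) s\<close> and \<open>act (g x) s\<close> are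
  \<open>a b s\<close> and \<open>b a s\<close>, and \<open>a\<close> commutes with \<open>b\<close> because conjugation by \<open>a\<close> is the action of
  \<open>d a\<close>.\<close>

lemma delta_lower_central:
  "\<lbrakk>x \<in> lower_central G j; t \<in> filtration (Suc m)\<rbrakk> \<Longrightarrow> delta x t \<in> filtration (Suc (Suc (m + j)))"
proof (induction j arbitrary: x t m)
  case 0
  then show ?case by (simp add: delta_filtration)
next
  case (Suc j)
  let ?H = "{x \<in> carrier G. \<forall>m. \<forall>t\<in>filtration (Suc m). delta x t \<in> filtration (Suc (Suc (m + Suc j)))}"
  have "subgroup ?H G"
  proof (rule G.subgroupI)
    show "?H \<noteq> {}"
      using filtration_closed subgroup.one_closed[OF subgroup_filtration]
      by (auto simp: delta_def intro!: exI[of _ "\<one>\<^bsub>G\<^esub>"])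
  next
    fix x assume x: "x \<in> ?H"
    have "delta (inv\<^bsub>G\<^esub> x) t \<in> filtration (Suc (Suc (m + Suc j)))" if t: "t \<in> filtration (Suc m)" for m t
    proof -
      have "act (inv\<^bsub>G\<^esub> x) (inv delta x t) \<in> filtration (Suc (Suc (m + Suc j)))"
        using x t by (intro act_filtration subgroup.m_inv_closed[OF subgroup_filtration]) auto
      moreover have "act (inv\<^bsub>G\<^esub> x) (inv delta x t) = delta (inv\<^bsub>G\<^esub> x) t"
        using x filtration_closed[OF t] by (simp add: delta_def act_distrib act_inv word_simps)
      ultimately show ?thesis by simp
    qed
    then show "inv\<^bsub>G\<^esub> x \<in> ?H" using x by blast
  next
    fix x y assume x: "x \<in> ?H" and y: "y \<in> ?H"
    have "delta (x \<otimes>\<^bsub>G\<^esub> y) t \<in> filtration (Suc (Suc (m + Suc j)))" if t: "t \<in> filtration (Suc m)" for m t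
    proof -
      have "delta (x \<otimes>\<^bsub>G\<^esub> y) t = act x (delta y t) \<otimes> delta x t"
        using x y filtration_closed[OF t] by (simp add: delta_def act_mult act_distrib act_inv word_simps)
      moreover have "act x (delta y t) \<in> filtration (Suc (Suc (m + Suc j)))"
        using x y t by (intro act_filtration) auto
      moreover have "delta x t \<in> filtration (Suc (Suc (m + Suc j)))"
        using x t by blast
      ultimately show ?thesis by (simp add: subgroup.m_closed[OF subgroup_filtration])
    qed
    then show "x \<otimes>\<^bsub>G\<^esub> y \<in> ?H" using x y by blast
  qed auto
  moreover have "G.commutator x g \<in> ?H" if x: "x \<in> lower_central G j" and g [simp]: "g \<in> carrier G" for x g
  proof -
    have [simp]: "x \<in> carrier G" using x subgroup.subset[OF G.subgroup_lower_central] by blast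
    have "delta (G.commutator x g) t \<in> filtration (Suc (Suc (m + Suc j)))" (is "_ \<in> ?N")
      if t: "t \<in> filtration (Suc m)" for m t
    proof -
      \<comment> \<open>With this choice \<open>t\<close> is the image of \<open>s\<close> under
        \<open>g x\<close>, and its translate by the commutator of \<open>x\<close> and
        \<open>g\<close> is the image of the same \<open>s\<close> under \<open>x g\<close>.\<close>
      define s where "s = act (inv\<^bsub>G\<^esub> (g \<otimes>\<^bsub>G\<^esub> x)) t"
      have s: "s \<in> filtration (Suc m)" unfolding s_def by (intro act_filtration t) simp
      note t' [simp] = filtration_closed[OF t] and s' [simp] = filtration_closed[OF s]
      define a b where "a = delta g s" and "b = delta x s"
      have a: "a \<in> filtration (Suc (Suc m))" unfolding a_def by (intro delta_filtration s) simp
      have b: "b \<in> filtration (Suc (Suc (m + j)))" unfolding b_def by (intro Suc.IH x s)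
      note a' [simp] = filtration_closed[OF a] and b' [simp] = filtration_closed[OF b]
      have "delta x a \<in> ?N" using Suc.IH[OF x a] by (simp)
      moreover have "delta g b \<in> ?N" using delta_filtration[OF g b] by (simp)
      moreover have "commutator a b \<in> ?N"
      proof -
        have "commutator a b = delta (d a) b" by (simp add: commutator_def delta_def peiffer)
        then show ?thesis using delta_filtration[OF _ b, of "d a"] by (simp)
      qed
      moreover have "delta (G.commutator x g) t = delta x a \<otimes> commutator a b \<otimes> inv delta g b"
      proof -
        have "t = act (g \<otimes>\<^bsub>G\<^esub> x) s" by (simp add: s_def)
        also have "\<dots> = delta g b \<otimes> b \<otimes> (a \<otimes> s)"
          by (simp add: a_def b_def delta_def act_mult act_distrib act_inv word_simps)
        finally have t: "t = delta g b \<otimes> b \<otimes> (a \<otimes> s)" .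
        have "act (G.commutator x g) t = act (x \<otimes>\<^bsub>G\<^esub> g) s"
          unfolding s_def by (simp add: G.commutator_def G.word_simps flip: act_mult)
        also have "\<dots> = delta x a \<otimes> a \<otimes> (b \<otimes> s)"
          by (simp add: a_def b_def delta_def act_mult act_distrib act_inv word_simps)
        finally have "delta (G.commutator x g) t
            = delta x a \<otimes> a \<otimes> (b \<otimes> s) \<otimes> inv (delta g b \<otimes> b \<otimes> (a \<otimes> s))"
          unfolding delta_def[of "G.commutator x g"] using t by simp
        then show ?thesis by (simp add: commutator_def word_simps)
      qed
      ultimately show ?thesis
        by (simp add: subgroup.m_closed[OF subgroup_filtration]
            subgroup.m_inv_closed[OF subgroup_filtration])
    qed
    then show ?thesis by simp
  qed
  ultimately have "lower_central G (Suc j) \<subseteq> ?H"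
    unfolding lower_central.simps G.commutator_def by (intro G.generate_subgroup_incl) blast+
  then show ?case using Suc.prems by auto
qed

text \<open>By \<open>peiffer\<close> the commutator of \<open>x\<close> and \<open>y\<close> is
  \<open>delta (d x) y\<close>, so \<open>d_filtration\<close> and
  \<open>delta_lower_central\<close> give its level. For \<open>j = 0\<close> the element
  \<open>y\<close> is regarded as one of level 1.\<close>

sublocale filtered_group L filtration
proof (intro filtered_group.intro filtered_group_axioms.intro group_axioms)
  show "subgroup (filtration i) L" for i by (rule subgroup_filtration)
  show "filtration (Suc i) \<subseteq> filtration i" for i by (rule filtration_Suc)
  show "commutator x y \<in> filtration (Suc (i + j))" if x: "x \<in> filtration i" and y: "y \<in> filtration j" for x y i j
  proof -
    have eq: "commutator x y = delta (d x) y"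
      using x y filtration_closed by (simp add: commutator_def delta_def peiffer)
    show ?thesis
    proof (cases j)
      case 0
      then have "delta (d x) y \<in> filtration (Suc (Suc (0 + i)))"
        using y by (intro delta_lower_central d_filtration x) simp
      then show ?thesis using filtration_Suc 0 by (auto simp: eq)
    next
      case (Suc k)
      then show ?thesis
        using delta_lower_central[OF d_filtration[OF x], of y k] y by (simp add: eq add.commute)
    qed
  qed
qed

end

section \<open>Orbit products as polynomial sequences\<close>

context tensor_pairing
begin

text \<open>The newest factor stands on the left, so that \<open>diff\<close> of the product is the
  orbit of \<open>c\<close>.\<close>

primrec orbit_prod :: "'g \<Rightarrow> 'l \<Rightarrow> nat \<Rightarrow> 'l" where
  "orbit_prod g c 0 = \<one>"
| "orbit_prod g c (Suc n) = act (g [^]\<^bsub>G\<^esub> n) c \<otimes> orbit_prod g c n"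

lemma orbit_prod_closed [simp]: "\<lbrakk>g \<in> carrier G; c \<in> carrier L\<rbrakk> \<Longrightarrow> orbit_prod g c n \<in> carrier L"
  by (induction n) simp_all

text \<open>Expansion in the second argument puts the newest factor on the right; passing to
  inverses moves it to the left, where \<open>orbit_prod\<close> has it.\<close>

lemma orbit_prod_w:
  assumes "g \<in> carrier G" "h \<in> carrier G"
  shows "orbit_prod g (w g h) n = w (g [^]\<^bsub>G\<^esub> n) h"
    and "orbit_prod h (inv w g h) n = inv w g (h [^]\<^bsub>G\<^esub> n)"
  using assms by (induction n) (simp_all add: w_mult_left w_mult_right act_inv inv_mult_group)

lemma orbit_prod_delta:
  assumes "g \<in> carrier G" "t \<in> carrier L"
  shows "orbit_prod g (delta g t) n = delta (g [^]\<^bsub>G\<^esub> n) t"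
  using assms by (induction n) (simp_all add: delta_def act_mult act_distrib act_inv word_simps)

lemma deltas_filtration:
  "\<lbrakk>g \<in> carrier G; c \<in> filtration (Suc k)\<rbrakk> \<Longrightarrow> (delta g ^^ n) c \<in> filtration (Suc (k + n))"
  by (induction n) (simp_all add: delta_filtration)

lemma diff_orbit:
  "\<lbrakk>g \<in> carrier G; c \<in> carrier L\<rbrakk>
    \<Longrightarrow> diff (\<lambda>n. act (g [^]\<^bsub>G\<^esub> n) c) = (\<lambda>n. act (g [^]\<^bsub>G\<^esub> n) (delta g c))"
  by (simp add: diff_def delta_def act_mult act_distrib act_inv fun_eq_iff)

lemma diffs_orbit:
  "\<lbrakk>g \<in> carrier G; c \<in> carrier L\<rbrakk>
    \<Longrightarrow> (diff ^^ k) (\<lambda>n. act (g [^]\<^bsub>G\<^esub> n) c) = (\<lambda>n. act (g [^]\<^bsub>G\<^esub> n) ((delta g ^^ k) c))"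
proof (induction k arbitrary: c)
  case (Suc k)
  then show ?case by (simp add: funpow_Suc_right diff_orbit del: funpow.simps(2))
qed simp

lemma diff_orbit_prod:
  "\<lbrakk>g \<in> carrier G; c \<in> carrier L\<rbrakk> \<Longrightarrow> diff (orbit_prod g c) = (\<lambda>n. act (g [^]\<^bsub>G\<^esub> n) c)"
  by (simp add: diff_def fun_eq_iff m_assoc)

lemma polyseq_orbit:
  assumes g: "g \<in> carrier G"
  shows "c \<in> filtration (Suc k) \<Longrightarrow> polyseq (Suc k) (\<lambda>n. act (g [^]\<^bsub>G\<^esub> n) c)"
  unfolding polyseq_def
proof
  fix m
  show "c \<in> filtration (Suc k) \<Longrightarrow> polyseq_upto m (Suc k) (\<lambda>n. act (g [^]\<^bsub>G\<^esub> n) c)"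
  proof (induction m arbitrary: c k)
    case 0
    then show ?case using g by (simp add: act_filtration)
  next
    case (Suc m)
    then show ?case
      using g filtration_closed[OF Suc.prems] Suc.IH[of "delta g c" "Suc k"]
      by (simp add: diff_orbit act_filtration delta_filtration)
  qed
qed

text \<open>The first difference is the orbit of \<open>c\<close>, a polynomial sequence from level
  \<open>k + 1\<close> on since each further difference applies \<open>delta g\<close> to the base
  point.\<close>

lemma polyseq_orbit_prod:
  assumes g: "g \<in> carrier G" and c: "c \<in> filtration (Suc k)"
  shows "polyseq k (orbit_prod g c)"
proof (rule polyseqI)
  have "orbit_prod g c n \<in> filtration (Suc k)" for n
    by (induction n)
      (use g c in \<open>simp_all add: act_filtration subgroup.m_closed[OF U_subgroup] subgroup.one_closed[OF U_subgroup]\<close>)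
  then show "orbit_prod g c n \<in> filtration k" for n using filtration_Suc by blast
  show "polyseq (Suc k) (diff (orbit_prod g c))"
    using polyseq_orbit[OF g c] diff_orbit_prod[OF g filtration_closed[OF c]] by simp
qed

text \<open>A homomorphism to \<open>A\<close> from the section \<open>filtration m\<close> modulo
  \<open>filtration (Suc m)\<close>, kept as a function on elements so that no quotient group has to
  be formed.\<close>

definition functional :: "nat \<Rightarrow> ('c, 'd) monoid_scheme \<Rightarrow> ('l \<Rightarrow> 'c) \<Rightarrow> bool" where
  "functional m A f \<longleftrightarrow>
    (\<forall>s\<in>filtration m. f s \<in> carrier A) \<and>
    (\<forall>s\<in>filtration m. \<forall>t\<in>filtration m. f (s \<otimes> t) = f s \<otimes>\<^bsub>A\<^esub> f t) \<and>
    (\<forall>s\<in>filtration (Suc m). f s = \<one>\<^bsub>A\<^esub>)"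

text \<open>In the product rule \<open>delta_mult\<close> the commutator lies deep enough for
  \<open>f\<close> to ignore it. Thus \<open>delta g\<close> induces an additive map from each
  section to the next.\<close>

lemma functional_delta:
  assumes A: "comm_group A" and f: "functional (Suc (Suc k)) A f" and g [simp]: "g \<in> carrier G"
  shows "functional (Suc k) A (\<lambda>t. f (delta g t))"
  unfolding functional_def
proof (intro conjI ballI)
  interpret A: comm_group A by (rule A)
  show "f (delta g s) \<in> carrier A" if "s \<in> filtration (Suc k)" for s
    using f that unfolding functional_def by (simp add: delta_filtration)
  show "f (delta g s) = \<one>\<^bsub>A\<^esub>" if "s \<in> filtration (Suc (Suc k))" for s
    using f that unfolding functional_def by (simp add: delta_filtration)
  fix s t assume s: "s \<in> filtration (Suc k)" and t: "t \<in> filtration (Suc k)"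
  note mem = delta_filtration[OF g s] delta_filtration[OF g t]
  have c: "commutator s (delta g t) \<in> filtration (Suc (Suc (Suc k)))"
    using U_commutator[OF s mem(2)] U_antimono[of "Suc (Suc (Suc k))" "Suc (Suc k + Suc (Suc k))"] by auto
  then have c': "commutator s (delta g t) \<in> filtration (Suc (Suc k))"
    using filtration_Suc by blast
  have "delta g (s \<otimes> t) = delta g s \<otimes> (commutator s (delta g t) \<otimes> delta g t)"
    using s t filtration_closed by (simp add: delta_mult)
  then show "f (delta g (s \<otimes> t)) = f (delta g s) \<otimes>\<^bsub>A\<^esub> f (delta g t)"
    using f mem c c' subgroup.m_closed[OF U_subgroup c' mem(2)] unfolding functional_def by simp
qed

text \<open>Additivity in the group element: the term \<open>delta g (delta h t)\<close> of
  \<open>delta_mult_left\<close> lies one level deeper than \<open>f\<close> can see.\<close>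

lemma functional_delta_mult:
  assumes A: "comm_group A" and f: "functional (Suc (Suc k)) A f"
    and g [simp]: "g \<in> carrier G" "h \<in> carrier G" and t: "t \<in> filtration (Suc k)"
  shows "f (delta (g \<otimes>\<^bsub>G\<^esub> h) t) = f (delta g t) \<otimes>\<^bsub>A\<^esub> f (delta h t)"
proof -
  interpret A: comm_group A by (rule A)
  have gt: "delta g t \<in> filtration (Suc (Suc k))" and ht: "delta h t \<in> filtration (Suc (Suc k))"
    using t by (simp_all add: delta_filtration)
  have ght: "delta g (delta h t) \<in> filtration (Suc (Suc (Suc k)))"
    using ht by (simp add: delta_filtration)
  then have ght': "delta g (delta h t) \<in> filtration (Suc (Suc k))"
    using filtration_Suc by blast
  have m: "delta h t \<otimes> delta g t \<in> filtration (Suc (Suc k))"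
    by (rule subgroup.m_closed[OF U_subgroup ht gt])
  have "delta (g \<otimes>\<^bsub>G\<^esub> h) t = delta g (delta h t) \<otimes> (delta h t \<otimes> delta g t)"
    using filtration_closed[OF t] by (simp add: delta_mult_left)
  then have "f (delta (g \<otimes>\<^bsub>G\<^esub> h) t) = f (delta h t) \<otimes>\<^bsub>A\<^esub> f (delta g t)"
    using f gt ht ght ght' m unfolding functional_def by simp
  then show ?thesis
    using f gt ht unfolding functional_def by (simp add: A.m_comm)
qed

lemma functional_delta_pow:
  assumes A: "comm_group A" and f: "functional (Suc (Suc k)) A f"
    and [simp]: "g \<in> carrier G" and t: "t \<in> filtration (Suc k)"
  shows "f (delta (g [^]\<^bsub>G\<^esub> (n::nat)) t) = f (delta g t) [^]\<^bsub>A\<^esub> n"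
proof (induction n)
  case 0
  have "delta \<one>\<^bsub>G\<^esub> t = \<one>" using filtration_closed[OF t] by (simp add: delta_def)
  then show ?case
    using f subgroup.one_closed[OF U_subgroup] unfolding functional_def by simp
next
  case (Suc n)
  then show ?case using functional_delta_mult[OF A f _ _ t] by simp
qed

text \<open>The \<open>n\<close>-th difference in \<open>t\<close> of \<open>(t X + Y)^n v\<close> is \<open>n! X^n v\<close>, where \<open>X\<close> and \<open>Y\<close> are the
  additive maps induced by \<open>delta x\<close> and \<open>delta y\<close> on the sections of the filtration.\<close>

lemma diffs_functional_deltas:
  assumes A: "comm_group A" and xy [simp]: "x \<in> carrier G" "y \<in> carrier G"
    and v: "v \<in> filtration (Suc k)"
  shows "functional (Suc (k + n)) A f \<Longrightarrow>
    (group.diff A ^^ n) (\<lambda>t. f ((delta (x [^]\<^bsub>G\<^esub> t \<otimes>\<^bsub>G\<^esub> y) ^^ n) v)) =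
    (\<lambda>t. f ((delta x ^^ n) v) [^]\<^bsub>A\<^esub> (fact n :: nat))"
proof (induction n arbitrary: f)
  interpret A: comm_group A by (rule A)
  case 0
  then show ?case using v by (simp add: functional_def)
next
  interpret A: comm_group A by (rule A)
  case (Suc n)
  define s where "s t = x [^]\<^bsub>G\<^esub> t \<otimes>\<^bsub>G\<^esub> y" for t :: nat
  have [simp]: "s t \<in> carrier G" for t by (simp add: s_def)
  define u where "u t = (delta (s t) ^^ n) v" for t
  have u: "u t \<in> filtration (Suc (k + n))" for t
    unfolding u_def by (rule deltas_filtration) (simp_all add: v)
  have f: "functional (Suc (Suc (k + n))) A f" using Suc.prems by simp
  define f1 f2 where "f1 = (\<lambda>t. f (delta y t))" and "f2 = (\<lambda>t. f (delta x t))"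
  have f1: "functional (Suc (k + n)) A f1" and f2: "functional (Suc (k + n)) A f2"
    unfolding f1_def f2_def by (rule functional_delta[OF A f]; simp)+
  define F1 F2 where "F1 = (\<lambda>t. f1 (u t))" and "F2 = (\<lambda>t. f2 (u t))"
  have Pi: "F1 \<in> UNIV \<rightarrow> carrier A" "F2 \<in> UNIV \<rightarrow> carrier A"
    using f1 f2 u by (auto simp: F1_def F2_def functional_def)
  define c where "c = f ((delta x ^^ Suc n) v)"
  have c: "c \<in> carrier A"
    using f deltas_filtration[OF xy(1) v, of "Suc n"] by (simp add: c_def functional_def)
  have d1: "(A.diff ^^ Suc n) F1 = (\<lambda>t. \<one>\<^bsub>A\<^esub>)"
  proof -
    have "f1 ((delta x ^^ n) v) \<in> carrier A"
      using f1 deltas_filtration[OF xy(1) v, of n] by (simp add: functional_def)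
    then show ?thesis
      using Suc.IH[OF f1] by (simp add: F1_def u_def s_def A.diff_const)
  qed
  have d2: "(A.diff ^^ n) F2 = (\<lambda>t. c [^]\<^bsub>A\<^esub> (fact n :: nat))"
    using Suc.IH[OF f2] by (simp add: F2_def u_def s_def f2_def c_def)
  \<comment> \<open>The outermost factor \<open>t X + Y\<close> is expanded: \<open>F2\<close>
    carries \<open>X\<close>, with multiplicity \<open>t\<close>, and \<open>F1\<close> carries
    \<open>Y\<close>. Then \<open>F1\<close> has degree \<open>n\<close> and drops out, while the
    Leibniz rule turns \<open>n!\<close> into \<open>(n + 1)!\<close>.\<close>
  have "f ((delta (s t) ^^ Suc n) v) = F2 t [^]\<^bsub>A\<^esub> t \<otimes>\<^bsub>A\<^esub> F1 t" for t
    using functional_delta_mult[OF A f _ _ u, of "x [^]\<^bsub>G\<^esub> t" y t]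
      functional_delta_pow[OF A f _ u, of x t t]
    by (simp add: F1_def F2_def f1_def f2_def u_def s_def)
  then have "(A.diff ^^ Suc n) (\<lambda>t. f ((delta (s t) ^^ Suc n) v))
      = (A.diff ^^ Suc n) (\<lambda>t. F2 t [^]\<^bsub>A\<^esub> t \<otimes>\<^bsub>A\<^esub> F1 t)" by presburger
  also have "\<dots> = (\<lambda>t. (A.diff ^^ Suc n) (\<lambda>t. F2 t [^]\<^bsub>A\<^esub> t) t \<otimes>\<^bsub>A\<^esub> (A.diff ^^ Suc n) F1 t)"
    using Pi by (intro A.diffs_mult_comm) auto
  also have "\<dots> = (\<lambda>t. c [^]\<^bsub>A\<^esub> (fact (Suc n) :: nat))"
    unfolding d1 A.diffs_power_index[OF Pi(2)] d2
    using c by (simp add: d2 A.diff_const A.nat_pow_pow mult.commute del: A.nat_pow_Suc fact_Suc) (simp add: A.nat_pow_mult add.commute)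
  finally show ?case by (simp add: s_def c_def)
qed

end

text \<open>Commutators of elements of \<open>U i\<close> lie in \<open>U (2 i + 1)\<close>, hence
  in \<open>U (i + 1)\<close>.\<close>

lemma (in filtered_group) subgroup_comm_group:
  assumes "U (Suc i) = {\<one>}"
  shows "comm_group (G\<lparr>carrier := U i\<rparr>)"
proof (rule group.group_comm_groupI)
  show "group (G\<lparr>carrier := U i\<rparr>)" by (rule subgroup_imp_group[OF U_subgroup])
  fix x y assume "x \<in> carrier (G\<lparr>carrier := U i\<rparr>)" "y \<in> carrier (G\<lparr>carrier := U i\<rparr>)"
  then have x: "x \<in> U i" and y: "y \<in> U i" by auto
  then have "commutator x y = \<one>"
    using U_commutator[OF x y] U_antimono[of "Suc i" "Suc (i + i)"] assms by auto
  moreover have "commutator x y \<otimes> (y \<otimes> x) = x \<otimes> y"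
    using x y U_closed by (simp add: commutator_def word_simps)
  ultimately show "x \<otimes>\<^bsub>G\<lparr>carrier := U i\<rparr>\<^esub> y = y \<otimes>\<^bsub>G\<lparr>carrier := U i\<rparr>\<^esub> x"
    using x y U_closed by simp
qed

lemma (in group) pow_subgroup: "x [^]\<^bsub>G\<lparr>carrier := H\<rparr>\<^esub> (n::nat) = x [^] n"
  by (induction n) simp_all

section \<open>The exponent of a tensor pairing\<close>

text \<open>Since \<open>lower_central G p\<close> is the term gamma_(p+1), the last assumption says
  that the class is at most \<open>p\<close>.\<close>

locale exponent_tensor_pairing = tensor_pairing +
  fixes p e q :: nat
  assumes p: "Factorial_Ring.prime p" and q: "q = p ^ e"
    and pow_q: "g \<in> carrier G \<Longrightarrow> g [^]\<^bsub>G\<^esub> q = \<one>\<^bsub>G\<^esub>"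
    and lower_central_p: "lower_central G p = {\<one>\<^bsub>G\<^esub>}"
begin

text \<open>Level \<open>p\<close> is mapped by \<open>d\<close> into
  \<open>lower_central G p\<close>, so its elements lie in the kernel of \<open>d\<close> and every
  \<open>delta\<close> annihilates them.\<close>

lemma filtration_trivial:
  assumes "p < k"
  shows "filtration k = {\<one>}"
proof -
  obtain m where m: "p = Suc m" using prime_gt_0_nat[OF p] not0_implies_Suc by blast
  have "filtration (Suc (Suc m)) \<subseteq> {\<one>}"
  proof (rule filtration_least)
    show "subgroup {\<one>} L" by (rule triv_subgroup)
    fix g t assume g: "g \<in> carrier G" and t: "t \<in> filtration (Suc m)"
    have "d t = \<one>\<^bsub>G\<^esub>" using d_filtration[OF t] lower_central_p m by (metis singletonD)
    then show "delta g t \<in> {\<one>}" using g filtration_closed[OF t] by (simp add: delta_trivial)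
  qed
  then have "filtration k \<subseteq> {\<one>}" using U_antimono[of "Suc p" k] assms m by auto
  then show ?thesis using subgroup.one_closed[OF U_subgroup[of k]] by blast
qed

text \<open>The power formula is applied to \<open>u^n v^n\<close>, whose value at 1 is
  \<open>u v\<close>. Both factors have degree 1 and \<open>1 < p\<close>, so the
  \<open>p\<close>-th difference is trivial by multiplicativity at the top.\<close>

lemma pow_mult_filtration:
  assumes exp: "\<And>s. s \<in> filtration (k + 2) \<Longrightarrow> s [^] q = \<one>"
    and u: "u \<in> filtration (Suc k)" and v: "v \<in> filtration (Suc k)"
  shows "(u \<otimes> v) [^] q = u [^] q \<otimes> v [^] q"
proof -
  have [simp]: "u \<in> carrier L" "v \<in> carrier L" using u v filtration_closed by auto
  have triv: "filtration (Suc (k + p)) = {\<one>}" by (rule filtration_trivial) simp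
  define f where "f = (\<lambda>n::nat. u [^] n \<otimes> v [^] n)"
  have "polyseq k f" unfolding f_def by (intro polyseq_mult polyseq_pow u v)
  moreover have "(diff ^^ p) f 0 = \<one>"
    unfolding f_def diffs_mult[OF polyseq_pow[OF u] polyseq_pow[OF v] triv]
    using diffs_pow_choose[of u 1 p] diffs_pow_choose[of v 1 p] prime_gt_1_nat[OF p] by simp
  ultimately show ?thesis
    using power_formula[OF p q, of k f] exp triv by (simp add: f_def)
qed

text \<open>The orbit product has value \<open>c\<close> at 1. Its first difference is the orbit of
  \<open>c\<close>, and the remaining \<open>p - 1\<close> differences apply \<open>delta g\<close>
  to \<open>c\<close>.\<close>

lemma orbit_prod_power:
  assumes exp: "\<And>s. s \<in> filtration (k + 2) \<Longrightarrow> s [^] q = \<one>"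
    and g: "g \<in> carrier G" and c: "c \<in> filtration (Suc k)"
  shows "orbit_prod g c q = c [^] q \<otimes> ((delta g ^^ (p - 1)) c) [^] (q choose p)"
proof -
  have cc: "c \<in> carrier L" using c filtration_closed by blast
  have dc: "(delta g ^^ j) c \<in> carrier L" for j
    using deltas_filtration[OF g c] filtration_closed by blast
  obtain m where m: "p = Suc m" using prime_gt_0_nat[OF p] not0_implies_Suc by blast
  have "(diff ^^ p) (orbit_prod g c) 0 = (delta g ^^ (p - 1)) c"
    using g cc dc by (simp add: m funpow_Suc_right diff_orbit_prod diffs_orbit del: funpow.simps(2))
  then show ?thesis
    using power_formula[OF p q polyseq_orbit_prod[OF g c]] exp filtration_trivial[of "Suc (k + p)"] g cc
    by simp
qed

text \<open>Descending induction on the level, with \<open>j\<close> bounding the distance to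
  \<open>p\<close>. For a generator \<open>delta g t\<close> the orbit product at \<open>q\<close>
  is \<open>delta (g^q) t\<close>, which is trivial, and the correction factor lies beyond level
  \<open>p\<close>. By \<open>pow_mult_filtration\<close> the elements killed by \<open>q\<close>
  form a subgroup.\<close>

lemma pow_filtration:
  assumes "s \<in> filtration (Suc (Suc k))"
  shows "s [^] q = \<one>"
proof -
  have "\<forall>s\<in>filtration (Suc (Suc k)). s [^] q = \<one>" if "p \<le> k + j" for j k
    using that
  proof (induction j arbitrary: k)
    case 0
    then show ?case using filtration_trivial[of "Suc (Suc k)"] by simp
  next
    case (Suc j)
    have exp: "s [^] q = \<one>" if "s \<in> filtration (Suc k + 2)" for s
      using Suc.IH[of "Suc k"] Suc.prems that by simp
    have "filtration (Suc (Suc k)) \<subseteq> {s \<in> filtration (Suc (Suc k)). s [^] q = \<one>}"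
    proof (rule filtration_least)
      show "subgroup {s \<in> filtration (Suc (Suc k)). s [^] q = \<one>} L"
      proof (rule subgroupI)
        show "{s \<in> filtration (Suc (Suc k)). s [^] q = \<one>} \<noteq> {}"
          using subgroup.one_closed[OF U_subgroup] by (auto intro!: exI[of _ \<one>])
      next
        fix s t
        assume "s \<in> {s \<in> filtration (Suc (Suc k)). s [^] q = \<one>}"
          "t \<in> {s \<in> filtration (Suc (Suc k)). s [^] q = \<one>}"
        then show "s \<otimes> t \<in> {s \<in> filtration (Suc (Suc k)). s [^] q = \<one>}"
          using pow_mult_filtration[of "Suc k" s t] exp by (simp add: subgroup.m_closed[OF U_subgroup])
      qed (use filtration_closed in \<open>auto simp: nat_pow_inv subgroup.m_inv_closed[OF U_subgroup]\<close>)
    next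
      fix g t assume g: "g \<in> carrier G" and t: "t \<in> filtration (Suc k)"
      have c: "delta g t \<in> filtration (Suc (Suc k))" by (rule delta_filtration[OF g t])
      have "(delta g ^^ (p - 1)) (delta g t) \<in> filtration (Suc (Suc k + (p - 1)))"
        by (rule deltas_filtration[OF g c])
      then have "(delta g ^^ (p - 1)) (delta g t) = \<one>"
        using filtration_trivial[of "Suc (Suc k + (p - 1))"] prime_gt_0_nat[OF p] by auto
      moreover have "orbit_prod g (delta g t) q = \<one>"
        using filtration_closed[OF t] g pow_q by (simp add: orbit_prod_delta) (simp add: delta_def)
      ultimately have "delta g t [^] q = \<one>"
        using orbit_prod_power[of "Suc k", OF _ g c] exp filtration_closed[OF c] by simp
      with c show "delta g t \<in> {s \<in> filtration (Suc (Suc k)). s [^] q = \<one>}" by simp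
    qed
    then show ?case by blast
  qed
  from this[of k p] show ?thesis using assms by simp
qed

lemma pow_mult_L: "\<lbrakk>s \<in> carrier L; t \<in> carrier L\<rbrakk> \<Longrightarrow> (s \<otimes> t) [^] q = s [^] q \<otimes> t [^] q"
  using pow_mult_filtration[of 0 s t] pow_filtration[of _ 0] by (simp add: numeral_2_eq_2)

text \<open>Symbols have level 1, so the iterated \<open>delta\<close> only reaches level
  \<open>p\<close>, which may be nontrivial; the correction factor therefore stays.\<close>

lemma pow_w_left:
  assumes "g \<in> carrier G" "h \<in> carrier G"
  shows "w g h [^] q \<otimes> ((delta g ^^ (p - 1)) (w g h)) [^] (q choose p) = \<one>"
  using orbit_prod_power[of 0 g "w g h"] pow_filtration[of _ 0] assms
  by (simp add: orbit_prod_w pow_q numeral_2_eq_2)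

lemma pow_inv_w_right:
  assumes "g \<in> carrier G" "h \<in> carrier G"
  shows "(inv w g h) [^] q \<otimes> ((delta h ^^ (p - 1)) (inv w g h)) [^] (q choose p) = \<one>"
  using orbit_prod_power[of 0 h "inv w g h"] pow_filtration[of _ 0] assms
  by (simp add: orbit_prod_w pow_q numeral_2_eq_2)

lemma delta_w_self:
  assumes "x \<in> carrier G" "g \<in> carrier G"
  shows "delta g (w x x [^] (n::nat)) = \<one>"
proof (rule delta_trivial)
  show "d (w x x [^] n) = \<one>\<^bsub>G\<^esub>"
    using assms by (simp add: d.hom_nat_pow d_w G.commutator_def G.word_simps)
qed (use assms in auto)

lemma deltas_trivial:
  assumes "g \<in> carrier G" "delta g s = \<one>"
  shows "(delta g ^^ (p - 1)) s = \<one>"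
proof -
  obtain m where m: "p - 1 = Suc m" using prime_gt_1_nat[OF p] by (metis Suc_diff_1 zero_less_diff)
  have "(delta g ^^ m) \<one> = \<one>" using assms(1) by (induction m) simp_all
  then show ?thesis unfolding m funpow_Suc_right by (simp add: assms(2))
qed

text \<open>Since \<open>d\<close> kills \<open>w x x\<close>, it is fixed by \<open>G\<close> and
  the correction factor in \<open>pow_w_left\<close> is trivial.\<close>

lemma pow_w_self:
  assumes x: "x \<in> carrier G"
  shows "w x x [^] q = \<one>"
  using pow_w_left[OF x x] deltas_trivial[OF x] delta_w_self[OF x x, of 1] x by simp

lemma functional_deltas:
  assumes A: "comm_group A" and g: "g \<in> carrier G"
  shows "functional (Suc n) A f \<Longrightarrow> functional (Suc 0) A (\<lambda>t. f ((delta g ^^ n) t))"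
proof (induction n arbitrary: f)
  case (Suc n)
  then show ?case using Suc.IH[OF functional_delta[OF A Suc.prems g]] by simp
qed simp

lemma pow_w:
  assumes x [simp]: "x \<in> carrier G" and y [simp]: "y \<in> carrier G"
  shows "w y x [^] q = \<one>"
proof -
  define v where "v = w y x"
  have v [simp]: "v \<in> carrier L" by (simp add: v_def)
  define C where "C = q choose p"
  obtain m where m: "p - 1 = Suc m" using prime_gt_1_nat[OF p] by (metis Suc_diff_1 zero_less_diff)
  have p_eq: "p = Suc (Suc m)" using m by simp
  \<comment> \<open>The last level that can be nontrivial; it is abelian and contains all correction
    factors.\<close>
  define A where "A = L\<lparr>carrier := filtration p\<rparr>"
  have A: "comm_group A"
    unfolding A_def by (rule subgroup_comm_group) (rule filtration_trivial, simp)
  interpret A: comm_group A by (rule A)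
  have A_simps [simp]: "carrier A = filtration p" "\<one>\<^bsub>A\<^esub> = \<one>" "s \<otimes>\<^bsub>A\<^esub> t = s \<otimes> t"
    "s [^]\<^bsub>A\<^esub> (n::nat) = s [^] n" for s t n
    by (simp_all add: A_def pow_subgroup)
  define f where "f s = s [^] C" for s
  have f: "functional p A f"
    unfolding functional_def
    using A.nat_pow_distrib[where n = C] filtration_trivial[of "Suc p"]
    by (auto simp: f_def subgroup_nat_pow_closed[OF U_subgroup])
  \<comment> \<open>\<open>F g (w g h)\<close> is the correction factor in
    \<open>pow_w_left\<close>. As a functional of level 1, \<open>F g\<close> is a homomorphism on
    all of \<open>L\<close> that kills every \<open>delta k s\<close>.\<close>
  define F where "F g s = f ((delta g ^^ (p - 1)) s)" for g s
  have F: "functional (Suc 0) A (F g)" if "g \<in> carrier G" for g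
    unfolding F_def using functional_deltas[OF A that, of "p - 1" f] f p_eq by simp
  have F_mult: "F g (s \<otimes> t) = F g s \<otimes> F g t"
    if "g \<in> carrier G" "s \<in> carrier L" "t \<in> carrier L" for g s t
    using F[OF that(1)] that by (simp add: functional_def)
  have F_A: "F g s \<in> filtration p" if "g \<in> carrier G" "s \<in> carrier L" for g s
    using F[OF that(1)] that by (simp add: functional_def)
  have F_delta: "F g (delta k s) = \<one>"
    if "g \<in> carrier G" "k \<in> carrier G" "s \<in> carrier L" for g k s
    using F[OF that(1)] that by (simp add: functional_def delta_filtration)
  have const: "F (x [^]\<^bsub>G\<^esub> t \<otimes>\<^bsub>G\<^esub> y) v = inv (v [^] q)" for t :: nat
  proof -
    define s where "s = x [^]\<^bsub>G\<^esub> t \<otimes>\<^bsub>G\<^esub> y"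
    have [simp]: "s \<in> carrier G" by (simp add: s_def)
    have "orbit_prod x (w x x) t = w x x [^] t"
      by (induction t) (use delta_w_self[OF x, of _ 1] in \<open>simp_all add: act_eq_delta flip: nat_pow_Suc2\<close>)
    then have w1: "w (x [^]\<^bsub>G\<^esub> t) x = w x x [^] t" by (simp add: orbit_prod_w)
    \<comment> \<open>The factor with \<open>delta\<close> and the power of \<open>w x x\<close> are
      both killed by \<open>q\<close> and by \<open>F s\<close>, so \<open>w s x\<close> can be
      replaced by \<open>v\<close> in \<open>pow_w_left\<close> at \<open>s\<close> and
      \<open>x\<close>.\<close>
    have ws: "w s x = delta (x [^]\<^bsub>G\<^esub> t) v \<otimes> v \<otimes> w x x [^] t"
      by (simp add: s_def w_mult_left w1 act_eq_delta flip: v_def)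
    have "(w x x [^] t) [^] q = \<one>"
      using pow_w_self[OF x] pow_eq_one_dvd[of "w x x" q "t * q"] by (simp add: nat_pow_pow)
    moreover have "delta (x [^]\<^bsub>G\<^esub> t) v [^] q = \<one>"
      by (rule pow_filtration[of _ 0]) (simp add: delta_filtration)
    ultimately have wq: "w s x [^] q = v [^] q"
      by (simp add: ws pow_mult_L)
    have "F s (w x x [^] t) = \<one>"
      using deltas_trivial[of s "w x x [^] t"] by (simp add: F_def f_def delta_w_self)
    then have "F s (w s x) = F s v"
      using F_A[of s v] filtration_closed by (simp add: ws F_mult F_delta)
    then have "v [^] q \<otimes> F s v = \<one>"
      using pow_w_left[of s x] wq by (simp add: F_def f_def C_def)
    then have "inv F s v = v [^] q"
      using F_A[of s v] filtration_closed by (intro inv_equality) simp_all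
    then show ?thesis
      using F_A[of s v] filtration_closed inv_inv[of "F s v"] by (simp add: s_def)
  qed
  have Fx [simp]: "F x v \<in> carrier L" "F x (inv v) \<in> carrier L"
    using F_A[of x v] F_A[of x "inv v"] filtration_closed by auto
  \<comment> \<open>The expansion in the second argument of \<open>w y x\<close> involves
    \<open>inv v\<close>. Additivity of \<open>F x\<close> turns it into
    \<open>F x v = inv v [^] q\<close>, so it suffices to show that \<open>F x v\<close> is
    trivial.\<close>
  have "F x v \<otimes> F x (inv v) = F x (v \<otimes> inv v)" by (rule F_mult[symmetric]) simp_all
  also have "\<dots> = \<one>" using deltas_trivial[of x \<one>] by (simp add: F_def f_def)
  finally have Fx_inv: "inv F x (inv v) = F x v" by (simp add: inv_equality)
  have "inv v [^] q \<otimes> F x (inv v) = \<one>"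
    using pow_inv_w_right[OF y x] by (simp add: F_def f_def C_def v_def)
  then have Fx_v: "F x v = inv v [^] q"
    unfolding Fx_inv[symmetric] by (intro inv_equality) simp_all
  \<comment> \<open>The top difference in \<open>t\<close> is computed in two ways: it is
    \<open>F x v\<close> to the power \<open>(p - 1)!\<close>, and it is trivial since
    \<open>const\<close> makes the sequence constant and \<open>p - 1\<close> is positive.\<close>
  have "(\<lambda>t. F x v [^]\<^bsub>A\<^esub> (fact (p - 1) :: nat))
      = (A.diff ^^ (p - 1)) (\<lambda>t. F (x [^]\<^bsub>G\<^esub> t \<otimes>\<^bsub>G\<^esub> y) v)"
    unfolding F_def using f p_eq by (intro diffs_functional_deltas[OF A x y, of v 0, symmetric]) simp_all
  also have "\<dots> = (\<lambda>t. \<one>)"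
  proof -
    have "inv (v [^] q) \<in> filtration p" using F_A[of "x [^]\<^bsub>G\<^esub> (0::nat) \<otimes>\<^bsub>G\<^esub> y" v] const[of 0] by simp
    then show ?thesis
      unfolding const m funpow_Suc_right o_apply using A.diffs_one by (simp add: A.diff_const)
  qed
  finally have "F x v [^] (fact (p - 1) :: nat) = \<one>"
    by (simp add: fun_eq_iff)
  \<comment> \<open>\<open>D\<close> has level \<open>p\<close>, which is at least 2, so
    \<open>q\<close> kills it, and \<open>q\<close> divides \<open>C * p\<close>.\<close>
  moreover have "F x v [^] p = \<one>"
  proof -
    define D where "D = (delta x ^^ (p - 1)) v"
    have D: "D \<in> filtration (Suc (Suc m))"
      unfolding D_def m using deltas_filtration[OF x, of v 0 "Suc m"] by simp
    have "q dvd C * p"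
      using prime_power_dvd_prime_mult_binomial[OF p, of e] unfolding C_def q by (subst mult.commute)
    then have "D [^] (C * p) = \<one>"
      by (rule pow_eq_one_dvd[OF filtration_closed[OF D] pow_filtration[OF D]])
    then show ?thesis
      unfolding F_def f_def D_def[symmetric] using nat_pow_pow[OF filtration_closed[OF D], of C p] by simp
  qed
  moreover have "coprime (fact (p - 1)) p"
  proof -
    have "\<not> p \<le> p - 1" using prime_gt_0_nat[OF p] by linarith
    then have "coprime p (fact (p - 1))"
      by (intro prime_imp_coprime[OF p]) (simp only: prime_dvd_fact_iff[OF p] not_False_eq_True)
    then show ?thesis by (simp only: coprime_commute)
  qed
  ultimately have "F x v = \<one>" using pow_coprime_eq_one[OF Fx(1)] by blast
  then have "inv (v [^] q) = \<one>" using Fx_v by (simp add: nat_pow_inv)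
  then show ?thesis using inv_eq_1_iff[of "v [^] q"] by (simp flip: v_def)
qed

text \<open>Raising to the power \<open>q\<close> is a homomorphism on \<open>L\<close> by
  \<open>pow_mult_L\<close>, and it kills the symbols.\<close>

theorem pow_L:
  assumes "t \<in> carrier L"
  shows "t [^] q = \<one>"
  using assms by (induction rule: L_induct) (simp_all add: pow_w pow_mult_L nat_pow_inv)

end

section \<open>Homomorphisms out of presented groups\<close>

definition word_eval :: "('a, 'b) monoid_scheme \<Rightarrow> ('x \<Rightarrow> 'a) \<Rightarrow> 'x word \<Rightarrow> 'a" where
  "word_eval K f u = foldr (\<lambda>(x, b) a. (if b then f x else inv\<^bsub>K\<^esub> f x) \<otimes>\<^bsub>K\<^esub> a) u \<one>\<^bsub>K\<^esub>"

text \<open>An arbitrary representative is evaluated; \<open>word_eval_cong\<close> gives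
  independence of the choice when the relations hold in the target.\<close>

definition presented_lift ::
    "'x set \<Rightarrow> ('x word \<times> 'x word) set \<Rightarrow> ('a, 'b) monoid_scheme \<Rightarrow> ('x \<Rightarrow> 'a) \<Rightarrow> 'x word set \<Rightarrow> 'a" where
  "presented_lift S R K f A = word_eval K f (SOME u. u \<in> A)"

context group
begin

lemma word_eval_closed: "\<lbrakk>f \<in> S \<rightarrow> carrier G; u \<in> words S\<rbrakk> \<Longrightarrow> word_eval G f u \<in> carrier G"
  unfolding words_def word_eval_def by (induction u) (auto simp: Pi_iff)

lemma word_eval_append:
  "\<lbrakk>f \<in> S \<rightarrow> carrier G; u \<in> words S; v \<in> words S\<rbrakk>
    \<Longrightarrow> word_eval G f (u @ v) = word_eval G f u \<otimes> word_eval G f v"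
proof (induction u)
  case Nil
  then show ?case using word_eval_closed[OF Nil(1,3)] by (simp add: word_eval_def)
next
  case (Cons a u)
  have u: "u \<in> words S" using Cons.prems by (simp add: words_def)
  obtain x b where a: "a = (x, b)" "x \<in> S" using Cons.prems by (auto simp: words_def)
  have "f x \<in> carrier G" using Cons.prems a by auto
  moreover have "word_eval G f (a # u) = (if b then f x else inv f x) \<otimes> word_eval G f u" for u
    by (simp add: word_eval_def a)
  ultimately show ?case
    using Cons.IH[OF Cons.prems(1) u Cons.prems(3)] word_eval_closed[OF Cons.prems(1) u]
      word_eval_closed[OF Cons.prems(1,3)] by (simp add: m_assoc)
qed

lemma word_eval_cong:
  assumes f: "f \<in> S \<rightarrow> carrier G" and R: "\<And>u v. (u, v) \<in> R \<Longrightarrow> word_eval G f u = word_eval G f v"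
  shows "(u, v) \<in> word_cong S R \<Longrightarrow> word_eval G f u = word_eval G f v"
proof (induction rule: word_cong.induct)
  case (cancel x b)
  then have "f x \<in> carrier G" using f by auto
  then show ?case by (simp add: word_eval_def)
next
  case (append u u' v v')
  then show ?case using word_eval_append[OF f] word_cong_words by metis
qed (use R in auto)

lemma presented_lift_class:
  assumes f: "f \<in> S \<rightarrow> carrier G" and R: "\<And>u v. (u, v) \<in> R \<Longrightarrow> word_eval G f u = word_eval G f v"
    and u: "u \<in> words S"
  shows "presented_lift S R G f (word_cong S R `` {u}) = word_eval G f u"
proof -
  have "u \<in> word_cong S R `` {u}" using u by (simp add: word_cong.refl)
  then have "(SOME v. v \<in> word_cong S R `` {u}) \<in> word_cong S R `` {u}" by (rule someI)
  then show ?thesis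
    using word_eval_cong[OF f R] unfolding presented_lift_def by (metis Image_singleton_iff)
qed

lemma presented_lift_hom:
  assumes f: "f \<in> S \<rightarrow> carrier G" and R: "\<And>u v. (u, v) \<in> R \<Longrightarrow> word_eval G f u = word_eval G f v"
  shows "presented_lift S R G f \<in> hom (presented_group S R) G"
    and "x \<in> S \<Longrightarrow> presented_lift S R G f (word_cong S R `` {[(x, True)]}) = f x"
proof -
  note lift = presented_lift_class[OF f R]
  have carrier: "carrier (presented_group S R) = (\<lambda>u. word_cong S R `` {u}) ` words S"
    by (auto simp: presented_group_def quotient_def)
  have app: "u @ v \<in> words S" if "u \<in> words S" "v \<in> words S" for u v :: "'c word"
    using that by (auto simp: words_def)
  show "presented_lift S R G f \<in> hom (presented_group S R) G"
    by (rule homI) (auto simp: carrier lift word_eval_closed[OF f] presented_group_mult app word_eval_append[OF f])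
  assume x: "x \<in> S"
  then have "[(x, True)] \<in> words S" "f x \<in> carrier G" using f by (auto simp: words_def)
  then show "presented_lift S R G f (word_cong S R `` {[(x, True)]}) = f x"
    by (simp add: lift word_eval_def)
qed

end

lemma carrier_presented_group_generate:
  "carrier (presented_group S R)
    \<subseteq> generate (presented_group S R) ((\<lambda>x. word_cong S R `` {[(x, True)]}) ` S)"
  (is "_ \<subseteq> generate ?P ?X")
proof -
  interpret P: group ?P by (rule group_presented_group)
  have one: "\<one>\<^bsub>?P\<^esub> = word_cong S R `` {[]}" by (simp add: presented_group_def)
  have "word_cong S R `` {u} \<in> generate ?P ?X" if "u \<in> words S" for u
    using that
  proof (induction u)
    case Nil
    show ?case unfolding one[symmetric] by (rule generate.one)
  next
    case (Cons a u)
    obtain x b where a: "a = (x, b)" and x: "x \<in> S" using Cons.prems by (auto simp: words_def)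
    have u: "u \<in> words S" using Cons.prems by (simp add: words_def)
    have letter: "[(x, b)] \<in> words S" for b using x by (simp add: words_def)
    then have car: "word_cong S R `` {[(x, b)]} \<in> carrier ?P" for b
      by (auto simp: presented_group_def quotient_def)
    have "word_cong S R `` {[(x, b)]} \<otimes>\<^bsub>?P\<^esub> word_cong S R `` {[(x, \<not> b)]} = \<one>\<^bsub>?P\<^esub>" for b
      using equiv_class_eq[OF equiv_word_cong word_cong.cancel[OF x, of b R]]
      by (simp add: presented_group_mult letter one)
    from this[of False] have "word_cong S R `` {[(x, False)]} = inv\<^bsub>?P\<^esub> (word_cong S R `` {[(x, True)]})"
      using P.inv_equality[symmetric] car by simp
    then have "word_cong S R `` {[a]} \<in> generate ?P ?X"
      using x by (cases b) (auto simp: a intro: generate.incl generate.inv)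
    then have "word_cong S R `` {[a]} \<otimes>\<^bsub>?P\<^esub> word_cong S R `` {u} \<in> generate ?P ?X"
      using Cons.IH[OF u] by (rule generate.eng)
    then show ?case using letter u by (simp add: presented_group_mult a)
  qed
  then show ?thesis by (auto simp: presented_group_def quotient_def)
qed

section \<open>The tensor square as a tensor pairing\<close>

context group
begin

lemma conj_by_simps:
  assumes "k \<in> carrier G" "g \<in> carrier G" "h \<in> carrier G"
  shows "conj_by G k (g \<otimes> h) = conj_by G k g \<otimes> conj_by G k h"
    and "conj_by G (k \<otimes> g) h = conj_by G k (conj_by G g h)"
    and "conj_by G k (conj_by G g h) = conj_by G (conj_by G k g) (conj_by G k h)"
    and "conj_by G \<one> h = h"
  using assms by (simp_all add: conj_by_def word_simps)

lemma group_tensor_square: "group (tensor_square G)"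
  unfolding tensor_square_def by (rule group_presented_group)

lemma tensor_closed [simp]:
  "\<lbrakk>g \<in> carrier G; h \<in> carrier G\<rbrakk> \<Longrightarrow> tensor G g h \<in> carrier (tensor_square G)"
  unfolding tensor_square_def tensor_def presented_group_def
  by (auto simp: words_def intro!: quotientI)

lemma tensor_mult:
  assumes "g \<in> carrier G" "g' \<in> carrier G" "h \<in> carrier G" "h' \<in> carrier G"
  shows "tensor G g h \<otimes>\<^bsub>tensor_square G\<^esub> tensor G g' h' =
    word_cong (carrier G \<times> carrier G) (tensor_relations G) `` {[((g, h), True), ((g', h'), True)]}"
  using assms unfolding tensor_square_def tensor_def
  by (subst presented_group_mult) (auto simp: words_def)

lemma tensor_mult_left:
  assumes "g \<in> carrier G" "g' \<in> carrier G" "h \<in> carrier G"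
  shows "tensor G (g \<otimes> g') h =
    tensor G (conj_by G g g') (conj_by G g h) \<otimes>\<^bsub>tensor_square G\<^esub> tensor G g h"
  using assms unfolding tensor_mult[OF conj_by_closed[OF assms(1,2)] assms(1) conj_by_closed[OF assms(1,3)] assms(3)]
  unfolding tensor_def
  by (intro equiv_class_eq[OF equiv_word_cong] word_cong.rel)
    (auto simp: tensor_relations_def words_def)

lemma tensor_mult_right:
  assumes "g \<in> carrier G" "h \<in> carrier G" "h' \<in> carrier G"
  shows "tensor G g (h \<otimes> h') =
    tensor G g h \<otimes>\<^bsub>tensor_square G\<^esub> tensor G (conj_by G h g) (conj_by G h h')"
  using assms unfolding tensor_mult[OF assms(1) conj_by_closed[OF assms(2,1)] assms(2) conj_by_closed[OF assms(2,3)]]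
  unfolding tensor_def
  by (intro equiv_class_eq[OF equiv_word_cong] word_cong.rel)
    (auto simp: tensor_relations_def words_def)

lemma generate_tensor:
  "carrier (tensor_square G)
    \<subseteq> generate (tensor_square G) (case_prod (tensor G) ` (carrier G \<times> carrier G))"
  using carrier_presented_group_generate[of "carrier G \<times> carrier G" "tensor_relations G"]
  by (simp add: tensor_square_def tensor_def case_prod_beta')

definition tensor_lift :: "('c, 'd) monoid_scheme \<Rightarrow> ('a \<Rightarrow> 'a \<Rightarrow> 'c) \<Rightarrow> ('a \<times> 'a) word set \<Rightarrow> 'c" where
  "tensor_lift K f =
    presented_lift (carrier G \<times> carrier G) (tensor_relations G) K (case_prod f)"

lemma tensor_lift:
  assumes K: "group K"
    and f: "\<And>g h. \<lbrakk>g \<in> carrier G; h \<in> carrier G\<rbrakk> \<Longrightarrow> f g h \<in> carrier K"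
    and left: "\<And>g g' h. \<lbrakk>g \<in> carrier G; g' \<in> carrier G; h \<in> carrier G\<rbrakk>
      \<Longrightarrow> f (g \<otimes> g') h = f (conj_by G g g') (conj_by G g h) \<otimes>\<^bsub>K\<^esub> f g h"
    and right: "\<And>g h h'. \<lbrakk>g \<in> carrier G; h \<in> carrier G; h' \<in> carrier G\<rbrakk>
      \<Longrightarrow> f g (h \<otimes> h') = f g h \<otimes>\<^bsub>K\<^esub> f (conj_by G h g) (conj_by G h h')"
  shows "tensor_lift K f \<in> hom (tensor_square G) K"
    and "\<lbrakk>g \<in> carrier G; h \<in> carrier G\<rbrakk> \<Longrightarrow> tensor_lift K f (tensor G g h) = f g h"
proof -
  interpret K: group K by (rule K)
  have Pi: "case_prod f \<in> carrier G \<times> carrier G \<rightarrow> carrier K" using f by auto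
  have rel: "word_eval K (case_prod f) u = word_eval K (case_prod f) v"
    if "(u, v) \<in> tensor_relations G" for u v
    using that unfolding tensor_relations_def
    by (auto simp: word_eval_def left right f)
  show "tensor_lift K f \<in> hom (tensor_square G) K"
    unfolding tensor_lift_def tensor_square_def by (rule K.presented_lift_hom(1)[OF Pi rel])
  show "tensor_lift K f (tensor G g h) = f g h" if "g \<in> carrier G" "h \<in> carrier G"
    using K.presented_lift_hom(2)[OF Pi rel, where x = "(g, h)"] that by (simp add: tensor_lift_def tensor_def)
qed

definition tensor_act :: "'a \<Rightarrow> ('a \<times> 'a) word set \<Rightarrow> ('a \<times> 'a) word set" where
  "tensor_act k = tensor_lift (tensor_square G) (\<lambda>g h. tensor G (conj_by G k g) (conj_by G k h))"

text \<open>Conjugation by \<open>k\<close> is an automorphism of \<open>G\<close>, so it permutes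
  the defining relations of the tensor square.\<close>

lemma tensor_act:
  assumes k: "k \<in> carrier G"
  shows "tensor_act k \<in> hom (tensor_square G) (tensor_square G)"
    and "\<lbrakk>g \<in> carrier G; h \<in> carrier G\<rbrakk>
      \<Longrightarrow> tensor_act k (tensor G g h) = tensor G (conj_by G k g) (conj_by G k h)"
proof -
  have left: "tensor G (conj_by G k (g \<otimes> g')) (conj_by G k h) =
      tensor G (conj_by G k (conj_by G g g')) (conj_by G k (conj_by G g h))
        \<otimes>\<^bsub>tensor_square G\<^esub> tensor G (conj_by G k g) (conj_by G k h)"
    if "g \<in> carrier G" "g' \<in> carrier G" "h \<in> carrier G" for g g' h
    using k that by (simp add: conj_by_simps(1) conj_by_simps(3)[of k g] tensor_mult_left)
  have right: "tensor G (conj_by G k g) (conj_by G k (h \<otimes> h')) =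
      tensor G (conj_by G k g) (conj_by G k h) \<otimes>\<^bsub>tensor_square G\<^esub>
        tensor G (conj_by G k (conj_by G h g)) (conj_by G k (conj_by G h h'))"
    if "g \<in> carrier G" "h \<in> carrier G" "h' \<in> carrier G" for g h h'
    using k that by (simp add: conj_by_simps(1) conj_by_simps(3)[of k h] tensor_mult_right)
  note lift = tensor_lift[OF group_tensor_square, of "\<lambda>g h. tensor G (conj_by G k g) (conj_by G k h)"]
  show "tensor_act k \<in> hom (tensor_square G) (tensor_square G)"
    unfolding tensor_act_def by (rule lift(1)) (use k left right in auto)
  show "tensor_act k (tensor G g h) = tensor G (conj_by G k g) (conj_by G k h)"
    if "g \<in> carrier G" "h \<in> carrier G"
    unfolding tensor_act_def by (rule lift(2)) (use k that left right in auto)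
qed

lemma tensor_lift_commutator:
  shows "tensor_lift G commutator \<in> hom (tensor_square G) G"
    and "\<lbrakk>g \<in> carrier G; h \<in> carrier G\<rbrakk> \<Longrightarrow> tensor_lift G commutator (tensor G g h) = commutator g h"
proof -
  have left: "commutator (g \<otimes> g') h = commutator (conj_by G g g') (conj_by G g h) \<otimes> commutator g h"
    and right: "commutator h (g \<otimes> g') = commutator h g \<otimes> commutator (conj_by G g h) (conj_by G g g')"
    if "g \<in> carrier G" "g' \<in> carrier G" "h \<in> carrier G" for g g' h
    using that by (simp_all add: commutator_def conj_by_def word_simps)
  note lift = tensor_lift[OF is_group, of commutator]
  show "tensor_lift G commutator \<in> hom (tensor_square G) G"
    by (rule lift(1)) (use left right in auto)
  show "tensor_lift G commutator (tensor G g h) = commutator g h"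
    if "g \<in> carrier G" "h \<in> carrier G"
    by (rule lift(2)) (use that left right in auto)
qed

lemma tensor_square_induct [consumes 1, case_names tensor one inv mult]:
  assumes "t \<in> carrier (tensor_square G)"
    and "\<And>g h. \<lbrakk>g \<in> carrier G; h \<in> carrier G\<rbrakk> \<Longrightarrow> P (tensor G g h)"
    and "P \<one>\<^bsub>tensor_square G\<^esub>"
    and "\<And>t. \<lbrakk>t \<in> carrier (tensor_square G); P t\<rbrakk> \<Longrightarrow> P (inv\<^bsub>tensor_square G\<^esub> t)"
    and "\<And>s t. \<lbrakk>s \<in> carrier (tensor_square G); t \<in> carrier (tensor_square G); P s; P t\<rbrakk>
      \<Longrightarrow> P (s \<otimes>\<^bsub>tensor_square G\<^esub> t)"
  shows "P t"
proof -
  interpret T: group "tensor_square G" by (rule group_tensor_square)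
  have "t \<in> generate (tensor_square G) (case_prod (tensor G) ` (carrier G \<times> carrier G))"
    by (rule subsetD[OF generate_tensor assms(1)])
  then have "t \<in> carrier (tensor_square G) \<and> P t"
    by (induction rule: generate.induct) (use assms in auto)
  then show ?thesis by simp
qed

lemma tensor_pairing_tensor_square:
  "tensor_pairing (tensor_square G) G tensor_act (tensor_lift G commutator) (tensor G)"
proof (intro tensor_pairing.intro tensor_pairing_axioms.intro)
  interpret T: group "tensor_square G" by (rule group_tensor_square)
  have act: "group_hom (tensor_square G) (tensor_square G) (tensor_act k)" if "k \<in> carrier G" for k
    using that by (simp add: group_hom_def group_hom_axioms_def tensor_act(1) T.is_group)
  note act_simps = group_hom.hom_mult[OF act] group_hom.hom_inv[OF act] group_hom.hom_one[OF act]
    group_hom.hom_closed[OF act]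
  show "tensor_act (g \<otimes> h) t = tensor_act g (tensor_act h t)"
    if "g \<in> carrier G" "h \<in> carrier G" and t: "t \<in> carrier (tensor_square G)" for g h t
    using t by (induction rule: tensor_square_induct)
      (use that in \<open>simp_all add: tensor_act(2) conj_by_simps(2) act_simps\<close>)
  show "tensor_act \<one> t = t" if "t \<in> carrier (tensor_square G)" for t
    using that by (induction rule: tensor_square_induct)
      (simp_all add: tensor_act(2) conj_by_simps(4) act_simps)
qed (simp_all add: group_tensor_square is_group tensor_act tensor_lift_commutator generate_tensor
    tensor_mult_left tensor_mult_right)

end

section \<open>Exponents\<close>

lemma group_exponent_eq:
  assumes "0 < n" "\<And>x. x \<in> carrier G \<Longrightarrow> x [^]\<^bsub>G\<^esub> (n::nat) = \<one>\<^bsub>G\<^esub>"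
  shows "group_exponent G = (LEAST n. 0 < n \<and> (\<forall>x\<in>carrier G. x [^]\<^bsub>G\<^esub> (n::nat) = \<one>\<^bsub>G\<^esub>))"
proof -
  have "\<exists>n>0. \<forall>x\<in>carrier G. x [^]\<^bsub>G\<^esub> (n::nat) = \<one>\<^bsub>G\<^esub>"
    by (intro exI conjI ballI) (rule assms; assumption)+
  then show ?thesis unfolding group_exponent_def by (rule if_P)
qed

lemma group_exponent_pos:
  assumes "0 < n" "\<And>x. x \<in> carrier G \<Longrightarrow> x [^]\<^bsub>G\<^esub> (n::nat) = \<one>\<^bsub>G\<^esub>"
  shows "0 < group_exponent G"
    and "x \<in> carrier G \<Longrightarrow> x [^]\<^bsub>G\<^esub> group_exponent G = \<one>\<^bsub>G\<^esub>"
proof -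
  let ?P = "\<lambda>n. 0 < n \<and> (\<forall>x\<in>carrier G. x [^]\<^bsub>G\<^esub> (n::nat) = \<one>\<^bsub>G\<^esub>)"
  have "?P n" by (intro conjI ballI assms)
  then have P: "?P (LEAST n. ?P n)" by (rule LeastI)
  have eq: "group_exponent G = (LEAST n. ?P n)" by (rule group_exponent_eq[OF assms])
  show "0 < group_exponent G" unfolding eq using P by (rule conjunct1)
  assume "x \<in> carrier G"
  then show "x [^]\<^bsub>G\<^esub> group_exponent G = \<one>\<^bsub>G\<^esub>"
    unfolding eq by (rule bspec[OF conjunct2[OF P]])
qed

lemma (in group) group_exponent_dvd:
  assumes "0 < n" and n: "\<And>x. x \<in> carrier G \<Longrightarrow> x [^] (n::nat) = \<one>"
  shows "group_exponent G dvd n"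
proof -
  let ?P = "\<lambda>n. 0 < n \<and> (\<forall>x\<in>carrier G. x [^] (n::nat) = \<one>)"
  define m where "m = group_exponent G"
  have m: "0 < m" unfolding m_def by (rule group_exponent_pos(1)[OF assms])
  have pow_m: "x [^] m = \<one>" if "x \<in> carrier G" for x
    unfolding m_def by (rule group_exponent_pos(2)[OF assms that])
  have mod: "x [^] (n mod m) = \<one>" if x: "x \<in> carrier G" for x
  proof -
    have "x [^] n = x [^] (m * (n div m) + n mod m)" by simp
    also have "\<dots> = (x [^] m) [^] (n div m) \<otimes> x [^] (n mod m)"
      using x by (simp only: nat_pow_pow nat_pow_mult nat_pow_closed)
    also have "\<dots> = x [^] (n mod m)" using x by (simp add: pow_m)
    finally show ?thesis using n[OF x] by simp
  qed
  have eq: "m = (LEAST n. ?P n)" unfolding m_def by (rule group_exponent_eq[OF assms])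
  have "n mod m < m" using m by (rule mod_less_divisor)
  then have "\<not> ?P (n mod m)" unfolding eq by (rule not_less_Least)
  then have "n mod m = 0" using mod by auto
  then show ?thesis by (simp add: m_def mod_eq_0_iff_dvd)
qed

lemma (in group) group_exponent_finite:
  assumes "finite (carrier G)"
  shows "0 < group_exponent G" and "x \<in> carrier G \<Longrightarrow> x [^] group_exponent G = \<one>"
proof -
  have "0 < order G" using assms by (simp add: order_gt_0_iff_finite)
  note pos = group_exponent_pos[OF this pow_order_eq_1]
  show "0 < group_exponent G" by (rule pos)
  show "x [^] group_exponent G = \<one>" if "x \<in> carrier G" by (rule pos(2)[OF _ that])
qed

text \<open>The finite bound excludes the empty set, so the infimum is attained at some
  \<open>b\<close>. Once trivial, the series stays trivial, which leads from \<open>b\<close> to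
  \<open>c\<close>.\<close>

lemma (in group) lower_central_trivial:
  assumes "nilpotency_class G \<le> enat c"
  shows "lower_central G c = {\<one>}"
proof -
  let ?S = "{enat c |c. lower_central G c = {\<one>}}"
  have "?S \<noteq> {}"
  proof
    assume "?S = {}"
    then have "nilpotency_class G = \<infinity>"
      unfolding nilpotency_class_def by (simp add: Inf_enat_def del: Collect_empty_eq)
    then show False using assms by simp
  qed
  then have "Inf ?S \<in> ?S"
    unfolding Inf_enat_def using LeastI[of "\<lambda>x. x \<in> ?S"] by (simp only: if_False) blast
  then obtain b where b: "nilpotency_class G = enat b" "lower_central G b = {\<one>}"
    unfolding nilpotency_class_def by auto
  then have "b \<le> c" using assms by simp
  then show ?thesis
  proof (induction c rule: dec_induct)
    case (step n)
    have "lower_central G (Suc n) \<subseteq> {\<one>}"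
      unfolding lower_central.simps step.IH by (intro generate_subgroup_incl triv_subgroup) auto
    then show ?case using subgroup.one_closed[OF subgroup_lower_central[of "Suc n"]] by blast
  qed (rule b)
qed

context group
begin

theorem pow_tensor_square:
  assumes "Factorial_Ring.prime p" "q = p ^ e"
    and "\<And>g. g \<in> carrier G \<Longrightarrow> g [^] q = \<one>" and "lower_central G p = {\<one>}"
    and "t \<in> carrier (tensor_square G)"
  shows "t [^]\<^bsub>tensor_square G\<^esub> q = \<one>\<^bsub>tensor_square G\<^esub>"
proof -
  interpret E: exponent_tensor_pairing "tensor_square G" G tensor_act "tensor_lift G commutator" "tensor G" p e q
    using assms by (intro exponent_tensor_pairing.intro tensor_pairing_tensor_square
        exponent_tensor_pairing_axioms.intro)
  show ?thesis by (rule E.pow_L) (rule assms(5))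
qed

text \<open>The commutator map kills \<open>x \<otimes> x\<close>, so by \<open>peiffer\<close> this
  element is central, and the generating set is invariant under conjugation.\<close>

lemma normal_nabla: "nabla G \<lhd> tensor_square G"
proof -
  interpret T: tensor_pairing "tensor_square G" G tensor_act "tensor_lift G commutator" "tensor G"
    by (rule tensor_pairing_tensor_square)
  show ?thesis
    unfolding nabla_def
  proof (rule T.normal_generateI)
    show "(\<lambda>x. tensor G x x) ` carrier G \<subseteq> carrier (tensor_square G)" by auto
    fix h g assume h: "h \<in> (\<lambda>x. tensor G x x) ` carrier G" and g: "g \<in> carrier (tensor_square G)"
    then obtain x where x: "x \<in> carrier G" "h = tensor G x x" by auto
    then have "tensor_lift G commutator h = \<one>"
      by (simp add: tensor_lift_commutator commutator_def word_simps)
    then have "g = h \<otimes>\<^bsub>tensor_square G\<^esub> g \<otimes>\<^bsub>tensor_square G\<^esub> inv\<^bsub>tensor_square G\<^esub> h"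
      using T.peiffer[of h g] x g by simp
    then have "g \<otimes>\<^bsub>tensor_square G\<^esub> h = h \<otimes>\<^bsub>tensor_square G\<^esub> g"
      using T.inv_solve_right[of g "h \<otimes>\<^bsub>tensor_square G\<^esub> g" h] x g by simp
    then have "h = g \<otimes>\<^bsub>tensor_square G\<^esub> h \<otimes>\<^bsub>tensor_square G\<^esub> inv\<^bsub>tensor_square G\<^esub> g"
      using x g by (intro T.conj_eqI) simp_all
    then show "g \<otimes>\<^bsub>tensor_square G\<^esub> h \<otimes>\<^bsub>tensor_square G\<^esub> inv\<^bsub>tensor_square G\<^esub> g
      \<in> (\<lambda>x. tensor G x x) ` carrier G" using h by simp
  qed
qed

end

section \<open>Central extensions\<close>

text \<open>Central factors cancel from commutators; in a central extension the commutator then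
  depends only on the images in the quotient.\<close>

lemma (in group) commutator_central:
  assumes "z \<in> carrier G" "z' \<in> carrier G" "x \<in> carrier G" "y \<in> carrier G"
    and z: "\<And>u. u \<in> carrier G \<Longrightarrow> z \<otimes> u = u \<otimes> z" and z': "\<And>u. u \<in> carrier G \<Longrightarrow> z' \<otimes> u = u \<otimes> z'"
  shows "commutator (z \<otimes> x) (z' \<otimes> y) = commutator x y"
proof -
  have "commutator (z \<otimes> x) (z' \<otimes> y) = z \<otimes> (x \<otimes> z' \<otimes> y \<otimes> inv x) \<otimes> inv z \<otimes> inv y \<otimes> inv z'"
    using assms(1-4) by (simp add: commutator_def word_simps)
  also have "\<dots> = z' \<otimes> (x \<otimes> y \<otimes> inv x \<otimes> inv y) \<otimes> inv z'"
  proof -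
    have "z \<otimes> (x \<otimes> z' \<otimes> y \<otimes> inv x) \<otimes> inv z = x \<otimes> z' \<otimes> y \<otimes> inv x"
      using assms(1-4) z[of "x \<otimes> z' \<otimes> y \<otimes> inv x"] by (simp add: word_simps)
    also have "\<dots> = z' \<otimes> x \<otimes> y \<otimes> inv x"
      using z'[of x] assms(3) by simp
    finally show ?thesis using assms(1-4) by (simp add: m_assoc)
  qed
  also have "\<dots> = commutator x y"
    using assms(1-4) z'[of "x \<otimes> y \<otimes> inv x \<otimes> inv y"] by (simp add: commutator_def m_assoc)
  finally show ?thesis .
qed

text \<open>The central extension of \<open>G\<close> by \<open>A\<close> for a cocycle that need
  not be normalized, whence the correction by \<open>\<kappa>\<close> at the identity in the
  unit.\<close>

definition cocycle_extension ::
    "('c, 'd) monoid_scheme \<Rightarrow> ('a, 'b) monoid_scheme \<Rightarrow> ('a \<Rightarrow> 'a \<Rightarrow> 'c) \<Rightarrow> ('c \<times> 'a) monoid" where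
  "cocycle_extension A G \<kappa> =
    \<lparr>carrier = carrier A \<times> carrier G,
     monoid.mult = (\<lambda>(a, g) (b, h). (a \<otimes>\<^bsub>A\<^esub> b \<otimes>\<^bsub>A\<^esub> \<kappa> g h, g \<otimes>\<^bsub>G\<^esub> h)),
     monoid.one = (inv\<^bsub>A\<^esub> \<kappa> \<one>\<^bsub>G\<^esub> \<one>\<^bsub>G\<^esub>, \<one>\<^bsub>G\<^esub>)\<rparr>"

locale cocycle = A: comm_group A + G: group G
  for A :: "('c, 'd) monoid_scheme" and G :: "('a, 'b) monoid_scheme" +
  fixes \<kappa> :: "'a \<Rightarrow> 'a \<Rightarrow> 'c"
  assumes \<kappa>_closed [simp]: "\<lbrakk>g \<in> carrier G; h \<in> carrier G\<rbrakk> \<Longrightarrow> \<kappa> g h \<in> carrier A"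
    and \<kappa>_cocycle: "\<lbrakk>g \<in> carrier G; h \<in> carrier G; k \<in> carrier G\<rbrakk>
      \<Longrightarrow> \<kappa> h k \<otimes>\<^bsub>A\<^esub> \<kappa> g (h \<otimes>\<^bsub>G\<^esub> k) = \<kappa> (g \<otimes>\<^bsub>G\<^esub> h) k \<otimes>\<^bsub>A\<^esub> \<kappa> g h"
begin

abbreviation "E \<equiv> cocycle_extension A G \<kappa>"

lemma \<kappa>_one:
  assumes [simp]: "g \<in> carrier G"
  shows "\<kappa> \<one>\<^bsub>G\<^esub> g = \<kappa> \<one>\<^bsub>G\<^esub> \<one>\<^bsub>G\<^esub>" "\<kappa> g \<one>\<^bsub>G\<^esub> = \<kappa> \<one>\<^bsub>G\<^esub> \<one>\<^bsub>G\<^esub>"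
  using \<kappa>_cocycle[of "\<one>\<^bsub>G\<^esub>" "\<one>\<^bsub>G\<^esub>" g] \<kappa>_cocycle[of g "\<one>\<^bsub>G\<^esub>" "\<one>\<^bsub>G\<^esub>"] by simp_all

lemma carrier_E: "carrier E = carrier A \<times> carrier G"
  by (simp add: cocycle_extension_def)

lemma mult_E [simp]: "(a, g) \<otimes>\<^bsub>E\<^esub> (b, h) = (a \<otimes>\<^bsub>A\<^esub> b \<otimes>\<^bsub>A\<^esub> \<kappa> g h, g \<otimes>\<^bsub>G\<^esub> h)"
  by (simp add: cocycle_extension_def)

lemma one_E: "\<one>\<^bsub>E\<^esub> = (inv\<^bsub>A\<^esub> \<kappa> \<one>\<^bsub>G\<^esub> \<one>\<^bsub>G\<^esub>, \<one>\<^bsub>G\<^esub>)"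
  by (simp add: cocycle_extension_def)

lemma group_E: "group E"
proof (rule groupI)
  fix x y z assume "x \<in> carrier E" "y \<in> carrier E" "z \<in> carrier E"
  then obtain a g b h c k where xyz: "x = (a, g)" "y = (b, h)" "z = (c, k)"
    and [simp]: "a \<in> carrier A" "b \<in> carrier A" "c \<in> carrier A"
      "g \<in> carrier G" "h \<in> carrier G" "k \<in> carrier G"
    by (auto simp: carrier_E)
  show "x \<otimes>\<^bsub>E\<^esub> y \<in> carrier E" by (simp add: xyz carrier_E)
  have "a \<otimes>\<^bsub>A\<^esub> b \<otimes>\<^bsub>A\<^esub> c \<otimes>\<^bsub>A\<^esub> (\<kappa> (g \<otimes>\<^bsub>G\<^esub> h) k \<otimes>\<^bsub>A\<^esub> \<kappa> g h)
      = a \<otimes>\<^bsub>A\<^esub> b \<otimes>\<^bsub>A\<^esub> c \<otimes>\<^bsub>A\<^esub> (\<kappa> h k \<otimes>\<^bsub>A\<^esub> \<kappa> g (h \<otimes>\<^bsub>G\<^esub> k))"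
    by (simp only: \<kappa>_cocycle \<open>g \<in> carrier G\<close> \<open>h \<in> carrier G\<close> \<open>k \<in> carrier G\<close>)
  then show "x \<otimes>\<^bsub>E\<^esub> y \<otimes>\<^bsub>E\<^esub> z = x \<otimes>\<^bsub>E\<^esub> (y \<otimes>\<^bsub>E\<^esub> z)"
    by (simp add: xyz G.m_assoc A.m_ac)
next
  show "\<one>\<^bsub>E\<^esub> \<in> carrier E" by (simp add: carrier_E one_E)
next
  fix x assume "x \<in> carrier E"
  then obtain a g where x: "x = (a, g)" and [simp]: "a \<in> carrier A" "g \<in> carrier G"
    by (auto simp: carrier_E)
  show "\<one>\<^bsub>E\<^esub> \<otimes>\<^bsub>E\<^esub> x = x" by (simp add: x one_E \<kappa>_one(1)[of g] A.m_ac)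
  define b where "b = inv\<^bsub>A\<^esub> \<kappa> \<one>\<^bsub>G\<^esub> \<one>\<^bsub>G\<^esub> \<otimes>\<^bsub>A\<^esub> inv\<^bsub>A\<^esub> \<kappa> (inv\<^bsub>G\<^esub> g) g \<otimes>\<^bsub>A\<^esub> inv\<^bsub>A\<^esub> a"
  have "(b, inv\<^bsub>G\<^esub> g) \<otimes>\<^bsub>E\<^esub> x = \<one>\<^bsub>E\<^esub>"
    by (simp add: x one_E b_def A.m_assoc A.word_simps)
  moreover have "(b, inv\<^bsub>G\<^esub> g) \<in> carrier E" by (simp add: carrier_E b_def)
  ultimately show "\<exists>y\<in>carrier E. y \<otimes>\<^bsub>E\<^esub> x = \<one>\<^bsub>E\<^esub>" by blast
qed

sublocale E: group E by (rule group_E)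

text \<open>The same correction makes the embedding of \<open>A\<close> a homomorphism.\<close>

definition incl :: "'c \<Rightarrow> 'c \<times> 'a" where
  "incl a = (a \<otimes>\<^bsub>A\<^esub> inv\<^bsub>A\<^esub> \<kappa> \<one>\<^bsub>G\<^esub> \<one>\<^bsub>G\<^esub>, \<one>\<^bsub>G\<^esub>)"

definition sect :: "'a \<Rightarrow> 'c \<times> 'a" where
  "sect g = (\<one>\<^bsub>A\<^esub>, g)"

lemma incl_closed [simp]: "a \<in> carrier A \<Longrightarrow> incl a \<in> carrier E"
  and sect_closed [simp]: "g \<in> carrier G \<Longrightarrow> sect g \<in> carrier E"
  by (simp_all add: incl_def sect_def carrier_E)

lemma incl_mult:
  assumes "a \<in> carrier A" "x \<in> carrier E"
  shows "incl a \<otimes>\<^bsub>E\<^esub> x = (a \<otimes>\<^bsub>A\<^esub> fst x, snd x)" "x \<otimes>\<^bsub>E\<^esub> incl a = (a \<otimes>\<^bsub>A\<^esub> fst x, snd x)"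
  using assms \<kappa>_one[of "snd x"] by (auto simp: incl_def carrier_E A.word_simps A.m_ac)

lemma incl_hom: "incl \<in> hom A E"
  by (rule homI) (simp_all add: incl_mult, simp add: incl_def A.m_ac)

lemma incl_inject: "\<lbrakk>a \<in> carrier A; b \<in> carrier A; incl a = incl b\<rbrakk> \<Longrightarrow> a = b"
  by (simp add: incl_def)

lemma sect_mult:
  "\<lbrakk>g \<in> carrier G; h \<in> carrier G\<rbrakk> \<Longrightarrow> sect g \<otimes>\<^bsub>E\<^esub> sect h = incl (\<kappa> g h) \<otimes>\<^bsub>E\<^esub> sect (g \<otimes>\<^bsub>G\<^esub> h)"
  by (simp add: incl_mult) (simp add: sect_def)

lemma commutator_E:
  assumes x: "x \<in> carrier E" and y: "y \<in> carrier E"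
  shows "E.commutator x y = E.commutator (sect (snd x)) (sect (snd y))"
proof -
  have "u = incl (fst u) \<otimes>\<^bsub>E\<^esub> sect (snd u)" if "u \<in> carrier E" for u
  proof -
    have u: "fst u \<in> carrier A" "snd u \<in> carrier G" using that by (auto simp: carrier_E)
    then show ?thesis using incl_mult(1)[OF u(1) sect_closed[OF u(2)]] by (simp add: sect_def)
  qed
  from this[OF x] this[OF y]
  have "x = incl (fst x) \<otimes>\<^bsub>E\<^esub> sect (snd x)" "y = incl (fst y) \<otimes>\<^bsub>E\<^esub> sect (snd y)" .
  moreover have "E.commutator (incl (fst x) \<otimes>\<^bsub>E\<^esub> sect (snd x)) (incl (fst y) \<otimes>\<^bsub>E\<^esub> sect (snd y))
      = E.commutator (sect (snd x)) (sect (snd y))"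
  proof -
    have "fst x \<in> carrier A" "snd x \<in> carrier G" "fst y \<in> carrier A" "snd y \<in> carrier G"
      using x y by (auto simp: carrier_E)
    then show ?thesis by (intro E.commutator_central) (simp_all add: incl_mult)
  qed
  ultimately show ?thesis by simp
qed

lemma snd_hom: "snd \<in> hom E G"
  by (rule homI) (auto simp: carrier_E)

lemma commutator_sect:
  assumes "x \<in> carrier E" "y \<in> carrier E" "g \<in> carrier G" "h \<in> carrier G" "snd x = g" "snd y = h"
  shows "E.commutator (sect g) (sect h) = E.commutator x y"
  using commutator_E[of x y] assms by simp

definition commutator_map :: "('a \<times> 'a) word set \<Rightarrow> 'c \<times> 'a" where
  "commutator_map = G.tensor_lift E (\<lambda>g h. E.commutator (sect g) (sect h))"

text \<open>Commutators in \<open>E\<close> depend only on images in \<open>G\<close>, so the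
  section may be treated as if it were multiplicative. The tensor relations then become commutator
  identities in \<open>E\<close>.\<close>

lemma commutator_map:
  shows "commutator_map \<in> hom (tensor_square G) E"
    and "\<lbrakk>g \<in> carrier G; h \<in> carrier G\<rbrakk>
      \<Longrightarrow> commutator_map (tensor G g h) = E.commutator (sect g) (sect h)"
proof -
  interpret snd: group_hom E G snd
    by (simp add: group_hom_def group_hom_axioms_def snd_hom group_E)
  have snd_sect [simp]: "snd (sect g) = g" for g by (simp add: sect_def)
  have conj: "E.commutator (sect (conj_by G g g')) (sect (conj_by G g h))
      = E.commutator (conj_by E (sect g) (sect g')) (conj_by E (sect g) (sect h))"
    if "g \<in> carrier G" "g' \<in> carrier G" "h \<in> carrier G" for g g' h
    using that by (intro commutator_sect) (simp_all add: conj_by_def)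
  have left: "E.commutator (sect (g \<otimes>\<^bsub>G\<^esub> g')) (sect h) =
      E.commutator (sect (conj_by G g g')) (sect (conj_by G g h)) \<otimes>\<^bsub>E\<^esub> E.commutator (sect g) (sect h)"
    and right: "E.commutator (sect h) (sect (g \<otimes>\<^bsub>G\<^esub> g')) =
      E.commutator (sect h) (sect g) \<otimes>\<^bsub>E\<^esub> E.commutator (sect (conj_by G g h)) (sect (conj_by G g g'))"
    if "g \<in> carrier G" "g' \<in> carrier G" "h \<in> carrier G" for g g' h
  proof -
    have l: "E.commutator (sect (g \<otimes>\<^bsub>G\<^esub> g')) (sect h) = E.commutator (sect g \<otimes>\<^bsub>E\<^esub> sect g') (sect h)"
      and r: "E.commutator (sect h) (sect (g \<otimes>\<^bsub>G\<^esub> g')) = E.commutator (sect h) (sect g \<otimes>\<^bsub>E\<^esub> sect g')"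
      using that by (intro commutator_sect; simp)+
    show "E.commutator (sect (g \<otimes>\<^bsub>G\<^esub> g')) (sect h) =
      E.commutator (sect (conj_by G g g')) (sect (conj_by G g h)) \<otimes>\<^bsub>E\<^esub> E.commutator (sect g) (sect h)"
      unfolding l conj[OF that] using that by (simp add: E.commutator_def conj_by_def E.word_simps del: mult_E)
    show "E.commutator (sect h) (sect (g \<otimes>\<^bsub>G\<^esub> g')) =
      E.commutator (sect h) (sect g) \<otimes>\<^bsub>E\<^esub> E.commutator (sect (conj_by G g h)) (sect (conj_by G g g'))"
      unfolding r conj[OF that(1,3,2)] using that by (simp add: E.commutator_def conj_by_def E.word_simps del: mult_E)
  qed
  note lift = G.tensor_lift[OF group_E, of "\<lambda>g h. E.commutator (sect g) (sect h)"]
  show "commutator_map \<in> hom (tensor_square G) E"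
    unfolding commutator_map_def by (rule lift(1)) (use left right in auto)
  show "commutator_map (tensor G g h) = E.commutator (sect g) (sect h)"
    if "g \<in> carrier G" "h \<in> carrier G"
    unfolding commutator_map_def by (rule lift(2)) (use that left right in auto)
qed

text \<open>Every commutator in \<open>E\<close> is the image of a symbol, and the image of
  \<open>commutator_map\<close> is a subgroup. This transfers the exponent of the tensor square to
  the commutator subgroup.\<close>

lemma derived_E: "derived E (carrier E) \<subseteq> commutator_map ` carrier (tensor_square G)"
proof -
  interpret c: group_hom "tensor_square G" E commutator_map
    by (simp add: group_hom_def group_hom_axioms_def commutator_map(1) group_E G.group_tensor_square)
  have "E.commutator x y \<in> commutator_map ` carrier (tensor_square G)"
    if x: "x \<in> carrier E" and y: "y \<in> carrier E" for x y
  proof -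
    have G: "snd x \<in> carrier G" "snd y \<in> carrier G" using x y by (auto simp: carrier_E)
    then have "E.commutator x y = commutator_map (tensor G (snd x) (snd y))"
      using commutator_E[OF x y] by (simp add: commutator_map(2))
    then show ?thesis using G by simp
  qed
  then show ?thesis
    unfolding derived_def E.commutator_def
    by (intro E.generate_subgroup_incl c.img_is_subgroup) blast
qed

end

section \<open>The Schur multiplier\<close>

lemma free_Abelian_group_diff_closed:
  "\<lbrakk>x \<in> carrier (free_Abelian_group S); y \<in> carrier (free_Abelian_group S)\<rbrakk>
    \<Longrightarrow> x - y \<in> carrier (free_Abelian_group S)"
  using keys_diff[of x y] by auto

lemma free_Abelian_group_add_closed:
  "\<lbrakk>x \<in> carrier (free_Abelian_group S); y \<in> carrier (free_Abelian_group S)\<rbrakk>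
    \<Longrightarrow> x + y \<in> carrier (free_Abelian_group S)"
  using keys_add[of x y] by auto

lemma frag_extend_hom:
  assumes "\<And>x. x \<in> S \<Longrightarrow> f x \<in> carrier (free_Abelian_group T)"
  shows "frag_extend f \<in> hom (free_Abelian_group S) (free_Abelian_group T)"
proof (rule homI)
  fix x assume "x \<in> carrier (free_Abelian_group S)"
  then have "Poly_Mapping.keys x \<subseteq> S" by simp
  then show "frag_extend f x \<in> carrier (free_Abelian_group T)"
  proof (rule free_Abelian_group_induct)
    show "frag_extend f 0 \<in> carrier (free_Abelian_group T)" by simp
    show "frag_extend f (x - y) \<in> carrier (free_Abelian_group T)"
      if "frag_extend f x \<in> carrier (free_Abelian_group T)"
        "frag_extend f y \<in> carrier (free_Abelian_group T)" for x y
      unfolding frag_extend_diff by (rule free_Abelian_group_diff_closed[OF that])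
    show "frag_extend f (frag_of a) \<in> carrier (free_Abelian_group T)" if "a \<in> S" for a
      using assms[OF that] by simp
  qed
qed (simp add: frag_extend_add)

lemma hom_free_Abelian_group_eq:
  assumes K: "group K" and f: "f \<in> hom (free_Abelian_group S) K" and g: "g \<in> hom (free_Abelian_group S) K"
    and eq: "\<And>x. x \<in> S \<Longrightarrow> f (frag_of x) = g (frag_of x)"
    and c: "c \<in> carrier (free_Abelian_group S)"
  shows "f c = g c"
proof -
  interpret f: group_hom "free_Abelian_group S" K f
    using K f by (simp add: group_hom_def group_hom_axioms_def)
  interpret g: group_hom "free_Abelian_group S" K g
    using K g by (simp add: group_hom_def group_hom_axioms_def)
  have minus: "x - y = x \<otimes>\<^bsub>free_Abelian_group S\<^esub> inv\<^bsub>free_Abelian_group S\<^esub> y"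
    if "Poly_Mapping.keys y \<subseteq> S" for x y
    using that by simp
  from c have "Poly_Mapping.keys c \<subseteq> S" by simp
  then show ?thesis
  proof (rule free_Abelian_group_induct)
    show "f 0 = g 0" using f.hom_one g.hom_one by simp
    show "f (x - y) = g (x - y)"
      if "Poly_Mapping.keys x \<subseteq> S" and y: "Poly_Mapping.keys y \<subseteq> S" and "f x = g x" "f y = g y" for x y
    proof -
      have "x \<in> carrier (free_Abelian_group S)" "y \<in> carrier (free_Abelian_group S)"
        using that by simp_all
      then show ?thesis
        unfolding minus[OF y] using that(3,4)
        by (simp del: mult_free_Abelian_group inv_free_Abelian_group carrier_free_Abelian_group_iff)
    qed
  qed (rule eq)
qed

section \<open>The bar complex and its universal cocycle\<close>

context group
begin

abbreviation (input) "bar_chains2 \<equiv> free_Abelian_group (carrier G \<times> carrier G)"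

lemma bar_d2_of: "bar_d2 G (frag_of (g, h)) = frag_of h - frag_of (g \<otimes> h) + frag_of g"
  by (simp add: bar_d2_def)

lemma bar_d3_of: "bar_d3 G (frag_of (g, h, k)) =
    frag_of (h, k) - frag_of (g \<otimes> h, k) + frag_of (g, h \<otimes> k) - frag_of (g, h)"
  by (simp add: bar_d3_def)

lemma bar_d2_hom: "bar_d2 G \<in> hom bar_chains2 (free_Abelian_group (carrier G))"
  unfolding bar_d2_def
  by (rule frag_extend_hom)
    (auto intro!: free_Abelian_group_diff_closed free_Abelian_group_add_closed
      simp del: carrier_free_Abelian_group_iff)

lemma bar_d3_hom: "bar_d3 G \<in> hom (free_Abelian_group (carrier G \<times> carrier G \<times> carrier G)) bar_chains2"
  unfolding bar_d3_def
  by (rule frag_extend_hom)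
    (auto intro!: free_Abelian_group_diff_closed free_Abelian_group_add_closed
      simp del: carrier_free_Abelian_group_iff)

lemma bar_d2_d3:
  assumes "c \<in> carrier (free_Abelian_group (carrier G \<times> carrier G \<times> carrier G))"
  shows "bar_d2 G (bar_d3 G c) = 0"
proof -
  have "(\<lambda>c. bar_d2 G (bar_d3 G c)) \<in> hom (free_Abelian_group (carrier G \<times> carrier G \<times> carrier G))
      (free_Abelian_group (carrier G))"
    using Group.hom_compose[OF bar_d3_hom bar_d2_hom] by (simp add: comp_def)
  moreover have "(\<lambda>c. 0) \<in> hom (free_Abelian_group (carrier G \<times> carrier G \<times> carrier G))
      (free_Abelian_group (carrier G))"
    by (rule homI) simp_all
  moreover have "bar_d2 G (bar_d3 G (frag_of x)) = 0" if x: "x \<in> carrier G \<times> carrier G \<times> carrier G" for x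
  proof -
    obtain g h k where "x = (g, h, k)" and "g \<in> carrier G" "h \<in> carrier G" "k \<in> carrier G"
      using x by auto
    then show ?thesis
      unfolding \<open>x = (g, h, k)\<close> bar_d3_of
      by (simp add: bar_d2_def frag_extend_add frag_extend_diff m_assoc)
  qed
  ultimately show ?thesis
    using hom_free_Abelian_group_eq[OF group_free_Abelian_group] assms by blast
qed

lemma subgroup_boundaries: "subgroup (bar_boundaries2 G) bar_chains2"
  unfolding bar_boundaries2_def
  by (intro group_hom.img_is_subgroup) (simp add: group_hom_def group_hom_axioms_def bar_d3_hom)

lemma subgroup_cycles: "subgroup (bar_cycles2 G) bar_chains2"
proof -
  interpret d2: group_hom bar_chains2 "free_Abelian_group (carrier G)" "bar_d2 G"
    by (simp add: group_hom_def group_hom_axioms_def bar_d2_hom)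
  have "bar_cycles2 G = kernel bar_chains2 (free_Abelian_group (carrier G)) (bar_d2 G)"
    by (auto simp: bar_cycles2_def kernel_def)
  then show ?thesis using d2.subgroup_kernel by simp
qed

lemma boundaries_subset_cycles: "bar_boundaries2 G \<subseteq> bar_cycles2 G"
  using bar_d2_d3 subgroup.subset[OF subgroup_boundaries]
  unfolding bar_boundaries2_def bar_cycles2_def by blast

lemma boundaries_normal:
  "bar_boundaries2 G \<lhd> bar_chains2\<lparr>carrier := bar_cycles2 G\<rparr>"
proof (rule comm_group.subgroup_imp_normal)
  show "comm_group (bar_chains2\<lparr>carrier := bar_cycles2 G\<rparr>)"
    by (rule group.group_comm_groupI)
      (simp_all add: group.subgroup_imp_group[OF group_free_Abelian_group subgroup_cycles] add.commute)
  show "subgroup (bar_boundaries2 G) (bar_chains2\<lparr>carrier := bar_cycles2 G\<rparr>)"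
    by (intro group.subgroup_incl[OF group_free_Abelian_group] subgroup_boundaries subgroup_cycles
        boundaries_subset_cycles)
qed

text \<open>Classes are taken in all 2-chains rather than only in cycles, because single symbols
  \<open>[g|h]\<close> must have classes to serve as cocycle values.\<close>

definition bar_class :: "('a \<times> 'a \<Rightarrow>\<^sub>0 int) \<Rightarrow> ('a \<times> 'a \<Rightarrow>\<^sub>0 int) set" where
  "bar_class c = bar_boundaries2 G #>\<^bsub>bar_chains2\<^esub> c"

lemma bar_class_hom: "bar_class \<in> hom bar_chains2 (bar_chains2 Mod bar_boundaries2 G)"
proof -
  have "bar_boundaries2 G \<lhd> bar_chains2"
    by (rule comm_group.subgroup_imp_normal[OF abelian_free_Abelian_group subgroup_boundaries])
  then show ?thesis unfolding bar_class_def using normal.r_coset_hom_Mod by blast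
qed

lemma bar_class_add_boundary:
  assumes "b \<in> bar_boundaries2 G" "c \<in> carrier bar_chains2"
  shows "bar_class (b + c) = bar_class c"
proof -
  interpret C: group bar_chains2 by simp
  have b: "b \<in> carrier bar_chains2" using assms(1) subgroup.subset[OF subgroup_boundaries] by blast
  have "bar_class (b \<otimes>\<^bsub>bar_chains2\<^esub> c) = bar_class b #>\<^bsub>bar_chains2\<^esub> c"
    unfolding bar_class_def
    by (rule C.coset_mult_assoc[symmetric, OF subgroup.subset[OF subgroup_boundaries] b assms(2)])
  also have "bar_class b = bar_boundaries2 G"
    unfolding bar_class_def by (rule C.coset_join2[OF b subgroup_boundaries assms(1)])
  finally show ?thesis by (simp add: bar_class_def)
qed

text \<open>The cocycle identity for \<open>[g|h]\<close> says exactly that the boundary of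
  \<open>[g|h|k]\<close> has trivial class.\<close>

lemma cocycle_bar_class:
  "cocycle (bar_chains2 Mod bar_boundaries2 G) G (\<lambda>g h. bar_class (frag_of (g, h)))"
proof (intro cocycle.intro cocycle_axioms.intro)
  let ?A = "bar_chains2 Mod bar_boundaries2 G"
  show "comm_group ?A"
    by (rule comm_group.abelian_FactGroup[OF abelian_free_Abelian_group subgroup_boundaries])
  show "group G" by (rule is_group)
  show "bar_class (frag_of (g, h)) \<in> carrier ?A" if "g \<in> carrier G" "h \<in> carrier G" for g h
    using that by (intro hom_in_carrier[OF bar_class_hom]) simp
  fix g h k assume [simp]: "g \<in> carrier G" "h \<in> carrier G" "k \<in> carrier G"
  let ?x = "frag_of (h, k) + frag_of (g, h \<otimes> k)" and ?y = "frag_of (g \<otimes> h, k) + frag_of (g, h)"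
  have "bar_d3 G (frag_of (g, h, k)) \<in> bar_boundaries2 G"
    unfolding bar_boundaries2_def by (rule imageI) simp
  moreover have "?x = bar_d3 G (frag_of (g, h, k)) + ?y" by (simp add: bar_d3_of)
  moreover have "?y \<in> carrier bar_chains2"
    by (intro free_Abelian_group_add_closed) simp_all
  ultimately have "bar_class ?x = bar_class ?y" using bar_class_add_boundary by metis
  moreover have "bar_class (x + y) = bar_class x \<otimes>\<^bsub>?A\<^esub> bar_class y"
    if "x \<in> carrier bar_chains2" "y \<in> carrier bar_chains2" for x y
    using hom_mult[OF bar_class_hom that] by (simp only: mult_free_Abelian_group)
  ultimately show "bar_class (frag_of (h, k)) \<otimes>\<^bsub>?A\<^esub> bar_class (frag_of (g, h \<otimes> k)) =
      bar_class (frag_of (g \<otimes> h, k)) \<otimes>\<^bsub>?A\<^esub> bar_class (frag_of (g, h))"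
    by simp
qed

text \<open>In the abelianization of the extension, the class of \<open>[g|h]\<close> is the image of its
  boundary under \<open>[g] \<mapsto> sect g\<close>; hence cycles lie in the commutator subgroup.\<close>

lemma pow_schur_class:
  assumes tensor: "\<And>t. t \<in> carrier (tensor_square G) \<Longrightarrow> t [^]\<^bsub>tensor_square G\<^esub> (q::nat) = \<one>\<^bsub>tensor_square G\<^esub>"
    and c: "c \<in> bar_cycles2 G"
  shows "bar_class (frag_cmul (int q) c) = bar_boundaries2 G"
proof -
  let ?A = "bar_chains2 Mod bar_boundaries2 G"
  interpret X: cocycle ?A G "\<lambda>g h. bar_class (frag_of (g, h))" by (rule cocycle_bar_class)
  interpret C: group bar_chains2 by simp
  interpret bar: group_hom bar_chains2 ?A bar_class
    by (simp add: group_hom_def group_hom_axioms_def bar_class_hom X.A.is_group)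
  have cC: "c \<in> carrier bar_chains2" using c by (simp add: bar_cycles2_def)
  define D where "D = derived X.E (carrier X.E)"
  have D: "D \<lhd> X.E" unfolding D_def by (rule X.E.derived_is_normal[OF X.E.normal_self])
  interpret Q: comm_group "X.E Mod D"
    unfolding D_def by (rule X.E.derived_quot_is_comm_group)
  define \<pi> where "\<pi> = (\<lambda>x. D #>\<^bsub>X.E\<^esub> x)"
  have \<pi>: "\<pi> \<in> hom X.E (X.E Mod D)" unfolding \<pi>_def by (rule normal.r_coset_hom_Mod[OF D])
  interpret \<pi>: group_hom X.E "X.E Mod D" \<pi>
    by (simp add: group_hom_def group_hom_axioms_def \<pi> X.group_E Q.is_group)
  \<comment> \<open>The section is not multiplicative, but the abelianization is commutative, so
    \<open>g \<mapsto> \<pi> (X.sect g)\<close> extends to the free abelian group of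
    1-chains.\<close>
  have "(\<lambda>g. \<pi> (X.sect g)) ` carrier G \<subseteq> carrier (X.E Mod D)"
    by (intro image_subsetI \<pi>.hom_closed X.sect_closed)
  then obtain \<sigma> where \<sigma>: "\<sigma> \<in> hom (free_Abelian_group (carrier G)) (X.E Mod D)"
      and \<sigma>_of: "\<And>g. g \<in> carrier G \<Longrightarrow> \<sigma> (frag_of g) = \<pi> (X.sect g)"
    by (rule Q.free_Abelian_group_universal) blast
  interpret \<sigma>: group_hom "free_Abelian_group (carrier G)" "X.E Mod D" \<sigma>
    by (simp add: group_hom_def group_hom_axioms_def \<sigma> Q.is_group)
  define \<iota> where "\<iota> c = X.incl (bar_class c)" for c
  have \<iota>: "\<iota> \<in> hom bar_chains2 X.E"
    using Group.hom_compose[OF bar_class_hom X.incl_hom] by (simp add: \<iota>_def[abs_def] comp_def)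
  interpret \<iota>: group_hom bar_chains2 X.E \<iota>
    by (simp add: group_hom_def group_hom_axioms_def \<iota> X.group_E)
  have "\<pi> (\<iota> c) = \<sigma> (bar_d2 G c)"
  proof (rule hom_free_Abelian_group_eq[OF Q.is_group _ _ _ cC])
    show "(\<lambda>c. \<pi> (\<iota> c)) \<in> hom bar_chains2 (X.E Mod D)"
      using Group.hom_compose[OF \<iota> \<pi>] by (simp add: comp_def)
    show "(\<lambda>c. \<sigma> (bar_d2 G c)) \<in> hom bar_chains2 (X.E Mod D)"
      using Group.hom_compose[OF bar_d2_hom \<sigma>] by (simp add: comp_def)
    fix x assume "x \<in> carrier G \<times> carrier G"
    then obtain g h where x: "x = (g, h)" and [simp]: "g \<in> carrier G" "h \<in> carrier G" by auto
    have ix: "\<iota> (frag_of x) \<in> carrier X.E" by (rule \<iota>.hom_closed) (simp add: x)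
    have gh: "\<pi> (X.sect g) \<in> carrier (X.E Mod D)" "\<pi> (X.sect h) \<in> carrier (X.E Mod D)"
        "\<pi> (X.sect (g \<otimes> h)) \<in> carrier (X.E Mod D)"
      by (intro \<pi>.hom_closed X.sect_closed; simp)+
    have "X.sect g \<otimes>\<^bsub>X.E\<^esub> X.sect h = \<iota> (frag_of x) \<otimes>\<^bsub>X.E\<^esub> X.sect (g \<otimes> h)"
      unfolding \<iota>_def x by (rule X.sect_mult) simp_all
    then have "\<pi> (X.sect g) \<otimes>\<^bsub>X.E Mod D\<^esub> \<pi> (X.sect h) =
        \<pi> (\<iota> (frag_of x)) \<otimes>\<^bsub>X.E Mod D\<^esub> \<pi> (X.sect (g \<otimes> h))"
      using \<pi>.hom_mult[of "X.sect g" "X.sect h"] \<pi>.hom_mult[OF ix, of "X.sect (g \<otimes> h)"]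
        X.sect_closed \<open>g \<in> carrier G\<close> \<open>h \<in> carrier G\<close> m_closed by metis
    then have 1: "\<pi> (\<iota> (frag_of x)) = \<pi> (X.sect g) \<otimes>\<^bsub>X.E Mod D\<^esub> \<pi> (X.sect h) \<otimes>\<^bsub>X.E Mod D\<^esub>
        inv\<^bsub>X.E Mod D\<^esub> \<pi> (X.sect (g \<otimes> h))"
      by (intro Q.inv_solve_right[THEN iffD2] Q.m_closed gh \<pi>.hom_closed[OF ix])
    have "bar_d2 G (frag_of x) = frag_of h \<otimes>\<^bsub>free_Abelian_group (carrier G)\<^esub>
        inv\<^bsub>free_Abelian_group (carrier G)\<^esub> frag_of (g \<otimes> h) \<otimes>\<^bsub>free_Abelian_group (carrier G)\<^esub> frag_of g"
      by (simp add: x bar_d2_of)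
    then have 2: "\<sigma> (bar_d2 G (frag_of x)) = \<pi> (X.sect h) \<otimes>\<^bsub>X.E Mod D\<^esub>
        inv\<^bsub>X.E Mod D\<^esub> \<pi> (X.sect (g \<otimes> h)) \<otimes>\<^bsub>X.E Mod D\<^esub> \<pi> (X.sect g)"
      by (simp add: \<sigma>_of del: mult_free_Abelian_group inv_free_Abelian_group mult_FactGroup
          carrier_free_Abelian_group_iff)
    note gh' = Q.inv_closed[OF gh(3)]
    show "\<pi> (\<iota> (frag_of x)) = \<sigma> (bar_d2 G (frag_of x))"
      unfolding 1 2 by (subst Q.m_assoc[OF gh(1,2) gh']) (rule Q.m_comm[OF gh(1) Q.m_closed[OF gh(2) gh']])
  qed
  also have "\<dots> = \<one>\<^bsub>X.E Mod D\<^esub>"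
    using c \<sigma>.hom_one by (simp add: bar_cycles2_def)
  finally have "\<iota> c \<in> D"
    unfolding \<pi>_def one_FactGroup
    by (rule X.E.coset_join1[OF _ \<iota>.hom_closed[OF cC] normal_imp_subgroup[OF D]])
  \<comment> \<open>The class of the cycle is thereby lifted to the tensor square, where
    \<open>q\<close> kills everything; injectivity of \<open>X.incl\<close> brings the relation
    back.\<close>
  then obtain t where t: "t \<in> carrier (tensor_square G)" "\<iota> c = X.commutator_map t"
    using X.derived_E unfolding D_def by blast
  interpret \<psi>: group_hom "tensor_square G" X.E X.commutator_map
    by (simp add: group_hom_def group_hom_axioms_def X.commutator_map(1) X.group_E group_tensor_square)
  have "\<iota> (c [^]\<^bsub>bar_chains2\<^esub> q) = X.commutator_map (t [^]\<^bsub>tensor_square G\<^esub> q)"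
    using t by (simp only: \<iota>.hom_nat_pow[OF cC] \<psi>.hom_nat_pow)
  also have "\<dots> = \<iota> \<one>\<^bsub>bar_chains2\<^esub>"
    using tensor[OF t(1)] by (simp only: \<psi>.hom_one \<iota>.hom_one)
  finally have "bar_class (c [^]\<^bsub>bar_chains2\<^esub> q) = bar_class \<one>\<^bsub>bar_chains2\<^esub>"
    unfolding \<iota>_def
    by (intro X.incl_inject bar.hom_closed C.nat_pow_closed C.one_closed cC)
  then show ?thesis unfolding bar.hom_one pow_free_Abelian_group one_FactGroup .
qed

lemma schur_multiplier_exponent_dvd:
  assumes "0 < q" and tensor: "\<And>t. t \<in> carrier (tensor_square G) \<Longrightarrow> t [^]\<^bsub>tensor_square G\<^esub> (q::nat) = \<one>\<^bsub>tensor_square G\<^esub>"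
  shows "group_exponent (schur_multiplier G) dvd q"
proof -
  note N = boundaries_normal
  have group: "group (schur_multiplier G)"
    unfolding schur_multiplier_def by (rule normal.factorgroup_is_group[OF N])
  show ?thesis
  proof (rule group.group_exponent_dvd[OF group \<open>0 < q\<close>])
    fix x assume "x \<in> carrier (schur_multiplier G)"
    then obtain c where c: "c \<in> bar_cycles2 G"
        and x: "x = bar_boundaries2 G #>\<^bsub>bar_chains2\<lparr>carrier := bar_cycles2 G\<rparr>\<^esub> c"
      unfolding schur_multiplier_def carrier_FactGroup by auto
    have "x [^]\<^bsub>schur_multiplier G\<^esub> q =
        bar_boundaries2 G #>\<^bsub>bar_chains2\<lparr>carrier := bar_cycles2 G\<rparr>\<^esub>
          (c [^]\<^bsub>bar_chains2\<lparr>carrier := bar_cycles2 G\<rparr>\<^esub> q)"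
      unfolding schur_multiplier_def x using c by (intro normal.FactGroup_pow[OF N]) simp
    \<comment> \<open>A coset of boundaries is the same set whether formed among the cycles or among
      all chains.\<close>
    also have "\<dots> = bar_class (frag_cmul (int q) c)"
      by (simp add: group.pow_subgroup bar_class_def r_coset_def)
    also have "\<dots> = \<one>\<^bsub>schur_multiplier G\<^esub>"
      using pow_schur_class[OF tensor c] by (simp add: schur_multiplier_def)
    finally show "x [^]\<^bsub>schur_multiplier G\<^esub> q = \<one>\<^bsub>schur_multiplier G\<^esub>" .
  qed
qed

lemma exterior_square_exponent_dvd:
  assumes "0 < q" and tensor: "\<And>t. t \<in> carrier (tensor_square G) \<Longrightarrow> t [^]\<^bsub>tensor_square G\<^esub> (q::nat) = \<one>\<^bsub>tensor_square G\<^esub>"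
  shows "group_exponent (exterior_square G) dvd q"
proof -
  note N = normal_nabla
  have group: "group (exterior_square G)"
    unfolding exterior_square_def by (rule normal.factorgroup_is_group[OF N])
  show ?thesis
  proof (rule group.group_exponent_dvd[OF group \<open>0 < q\<close>])
    fix x assume "x \<in> carrier (exterior_square G)"
    then obtain t where t: "t \<in> carrier (tensor_square G)" and x: "x = nabla G #>\<^bsub>tensor_square G\<^esub> t"
      unfolding exterior_square_def carrier_FactGroup by auto
    have "x [^]\<^bsub>exterior_square G\<^esub> q = nabla G #>\<^bsub>tensor_square G\<^esub> (t [^]\<^bsub>tensor_square G\<^esub> q)"
      unfolding exterior_square_def x by (rule normal.FactGroup_pow[OF N t])
    also have "\<dots> = nabla G"
      unfolding tensor[OF t]
      using group.coset_mult_one[OF group_tensor_square normal_imp_subgroup[OF N, THEN subgroup.subset]] .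
    finally show "x [^]\<^bsub>exterior_square G\<^esub> q = \<one>\<^bsub>exterior_square G\<^esub>"
      by (simp add: exterior_square_def)
  qed
qed

end

theorem theorem3p11:
  fixes G :: "('a, 'b) monoid_scheme" and p n :: nat
  assumes "Factorial_Ring.prime p" and "odd p"
    and "group G" and "finite (carrier G)" and "order G = p ^ n"
    and "nilpotency_class G \<le> enat p"
  shows "group_exponent (exterior_square G) dvd group_exponent G
       \<and> group_exponent (schur_multiplier G) dvd group_exponent G"
proof -
  interpret group G by (rule assms(3))
  let ?q = "group_exponent G"
  note pos = group_exponent_finite(1)[OF assms(4)] and pow = group_exponent_finite(2)[OF assms(4)]
  \<comment> \<open>The exponent divides the order, hence is itself a power of \<open>p\<close>, as
    \<open>pow_tensor_square\<close> requires.\<close>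
  have "?q dvd p ^ n"
    using pow_order_eq_1 assms(1,5) by (intro group_exponent_dvd) (auto simp: prime_gt_0_nat)
  then obtain e where e: "?q = p ^ e"
    using divides_primepow_nat[OF assms(1)] by blast
  have tensor: "t [^]\<^bsub>tensor_square G\<^esub> ?q = \<one>\<^bsub>tensor_square G\<^esub>" if "t \<in> carrier (tensor_square G)" for t
    by (rule pow_tensor_square[OF assms(1) e pow lower_central_trivial[OF assms(6)] that])
  show ?thesis
    using exterior_square_exponent_dvd[OF pos tensor] schur_multiplier_exponent_dvd[OF pos tensor] by blast
qed

end
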